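(* Assume that $\|f\|_\infty<\infty$ and that $K(u,v)=K^{(1)}(u)K^{(2)}(v)$ with $K^{(1)}$ supported in $[-A,A]^{d_1}$. Then there is a real constant $C_1$ depending only on $\|K\|_1$ and $\|f\|_\infty$ such that for every $n$ and every $h\in\mathcal H_n$, $$R_x^2(\hat f_h,2)\ \ge\ \|K_h*f-f\|_{x,2}^2+\frac{\|K^{(2)}\|_2^2}{n\prod_{i=1}^d h_i}\int_{\mathbb R^{d_1}}\frac{[K^{(1)}(s)]^2}{\mathrm f_X\big(x-(s_1h_1,\dots,s_{d_1}h_{d_1})\big)}\,ds+\frac{C_1}{n}.$$ If moreover $\mathrm f_X$ is positive and continuous on a neighborhood of $x$ and $\max\mathcal H_n:=\max_{h\in\mathcal H_n}\max_{1\le i\le d}h_i\to0$ as $n\to\infty$, then $$R_x^2(\hat f_h,2)\ \ge\ \|K_h*f-f\|_{x,2}^2+\frac{\|K\|_2^2}{\mathrm f_X(x)\,n\prod_{i=1}^d h_i}\,(1+o(1))+O\!\left(\frac1n\right)\qquad (n\to\infty).$$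
   Context: Let $d_1,d_2\ge1$, $d=d_1+d_2$, and let $(X_i,Y_i)_{i=1,\dots,n}$ be i.i.d. in $\mathbb R^{d_1}\times\mathbb R^{d_2}$ with joint density $f_{X,Y}$; $\mathrm f_X$ denotes the marginal density of $X_i$, which is here known and positive, and $f(t,y)=f_{X,Y}(t,y)/\mathrm f_X(t)$ is the conditional density of $Y_i$ given $X_i=t$. The point $x\in\mathbb R^{d_1}$ is fixed. $A>0$ is fixed, $(k_n)_n$ is a sequence of reals larger than $1$ with $k_n\to+\infty$, $V_n(x)=\prod_{i=1}^{d_1}[x_i-2A/k_n,\,x_i+2A/k_n]$, and $\|f\|_\infty=\sup_{t\in V_n(x)}\sup_{y\in\mathbb R^{d_2}}f(t,y)$. For a function $g$ on $\mathbb R^{d_1}\times\mathbb R^{d_2}$, $\|g\|_{x,2}=(\int_{\mathbb R^{d_2}}g^2(x,y)\,dy)^{1/2}$. The risk is $R_x(\hat f,q)=(\mathbb E[\|\hat f-f\|_{x,2}^q])^{1/q}$, and $\|\cdot\|_q$ is the usual $\mathbb L_q$-norm. The kernel $K:\mathbb R^{d_1}\times\mathbb R^{d_2}\to\mathbb R$ is bounded and integrable with $\iint K=1$ and $\|K\|_2<\infty$. For a bandwidth $h=(h_1,\dots,h_d)\in(0,\infty)^d$, $$K_h(u,v)=\frac1{\prod_{i=1}^dh_i}K\Big(\frac{u_1}{h_1},\dots,\frac{u_{d_1}}{h_{d_1}},\frac{v_1}{h_{d_1+1}},\dots,\frac{v_{d_2}}{h_d}\Big),$$ $*$ is convolution on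 $\mathbb R^d$, and $$\hat f_h(x,y)=\frac1n\sum_{i=1}^n\frac1{\mathrm f_X(X_i)}K_h(x-X_i,y-Y_i).$$ $\mathcal H_n$ is a set of bandwidths $h$ with $h_i\le 1/k_n$ for all $i\in\{1,\dots,d_1\}$. *)

theory Defs
  imports "HOL-Probability.Probability" "HOL-Library.Landau_Symbols"
begin

text \<open>
  Integrals that may diverge (norms, risk, supremum of a density) are taken in \<^typ>\<open>ennreal\<close>, so
  that no finiteness is presupposed. The exponent \<open>p\<close> is meant to be positive in the next definition.
\<close>

definition ennpowr :: "ennreal \<Rightarrow> real \<Rightarrow> ennreal" where
  "ennpowr a p = (if a = \<infinity> then \<infinity> else ennreal (enn2real a powr p))"

definition Lnorm :: "real \<Rightarrow> ('a::euclidean_space \<Rightarrow> real) \<Rightarrow> ennreal" where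
  "Lnorm q g = ennpowr (\<integral>\<^sup>+ z. ennreal (\<bar>g z\<bar> powr q) \<partial>lborel) (1 / q)"

definition section_norm ::
  "'a \<Rightarrow> real \<Rightarrow> ('a \<times> 'b::euclidean_space \<Rightarrow> real) \<Rightarrow> ennreal" where
  "section_norm x q g = Lnorm q (\<lambda>y. g (x, y))"

definition risk ::
  "'w measure \<Rightarrow> 'a \<Rightarrow> ('a \<times> 'b::euclidean_space \<Rightarrow> real) \<Rightarrow> ('w \<Rightarrow> 'a \<times> 'b \<Rightarrow> real) \<Rightarrow> real \<Rightarrow> ennreal"
where
  "risk M x f fhat q =
     ennpowr (\<integral>\<^sup>+ \<omega>. ennpowr (section_norm x 2 (\<lambda>z. fhat \<omega> z - f z)) q \<partial>M) (1 / q)"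

definition cond_density :: "('a \<times> 'b \<Rightarrow> real) \<Rightarrow> ('a \<Rightarrow> real) \<Rightarrow> 'a \<times> 'b \<Rightarrow> real" where
  "cond_density fXY fX = (\<lambda>(t, y). fXY (t, y) / fX t)"

definition iid_sample ::
  "'w measure \<Rightarrow> nat \<Rightarrow> (nat \<Rightarrow> 'w \<Rightarrow> 'a::euclidean_space) \<Rightarrow> (nat \<Rightarrow> 'w \<Rightarrow> 'b::euclidean_space)
     \<Rightarrow> ('a \<times> 'b \<Rightarrow> real) \<Rightarrow> bool" where
  "iid_sample M n X Y fXY \<longleftrightarrow>
     prob_space M \<and>
     prob_space.indep_vars M (\<lambda>_. borel) (\<lambda>i \<omega>. (X i \<omega>, Y i \<omega>)) {1..n} \<and>
     (\<forall>i\<in>{1..n}. distributed M lborel (\<lambda>\<omega>. (X i \<omega>, Y i \<omega>)) (\<lambda>z. ennreal (fXY z)))"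

definition nbhd_box :: "real \<Rightarrow> real ^ 'a \<Rightarrow> real \<Rightarrow> (real ^ 'a) set" where
  "nbhd_box A x k = {t. \<forall>i. x $ i - 2 * A / k \<le> t $ i \<and> t $ i \<le> x $ i + 2 * A / k}"

definition sup_on :: "'a set \<Rightarrow> ('a \<times> 'b \<Rightarrow> real) \<Rightarrow> ennreal" where
  "sup_on V f = (SUP t\<in>V. SUP y. ennreal (f (t, y)))"

text \<open>
  A bandwidth is a vector \<open>h\<close> indexed by the sum type: \<open>h $ Inl i\<close> are the first \<open>d\<^sub>1\<close> coordinates
  and \<open>h $ Inr j\<close> the last \<open>d\<^sub>2\<close>.
\<close>

definition scaled_kernel ::
  "((real ^ 'a) \<times> (real ^ 'b) \<Rightarrow> real) \<Rightarrow> real ^ ('a::finite + 'b::finite)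
     \<Rightarrow> (real ^ 'a) \<times> (real ^ 'b) \<Rightarrow> real" where
  "scaled_kernel K h = (\<lambda>(u, v).
     1 / (\<Prod>i\<in>UNIV. h $ i) * K (\<chi> i. u $ i / h $ Inl i, \<chi> j. v $ j / h $ Inr j))"

definition conv :: "('a::euclidean_space \<Rightarrow> real) \<Rightarrow> ('a \<Rightarrow> real) \<Rightarrow> 'a \<Rightarrow> real" where
  "conv g f z = (LINT w|lborel. g (z - w) * f w)"

definition kernel_estimator ::
  "nat \<Rightarrow> (real ^ 'a \<Rightarrow> real) \<Rightarrow> ((real ^ 'a) \<times> (real ^ 'b) \<Rightarrow> real)
     \<Rightarrow> (nat \<Rightarrow> 'w \<Rightarrow> real ^ 'a) \<Rightarrow> (nat \<Rightarrow> 'w \<Rightarrow> real ^ 'b) \<Rightarrow> real ^ ('a::finite + 'b::finite)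
     \<Rightarrow> 'w \<Rightarrow> (real ^ 'a) \<times> (real ^ 'b) \<Rightarrow> real" where
  "kernel_estimator n fX K X Y h \<omega> = (\<lambda>(x, y).
     1 / real n * (\<Sum>i=1..n. 1 / fX (X i \<omega>) * scaled_kernel K h (x - X i \<omega>, y - Y i \<omega>)))"

text \<open>Largest bandwidth coordinate in \<open>H\<close>, as a supremum, since \<open>H\<close> need not be finite.\<close>

definition max_bandwidth :: "(real ^ 'd) set \<Rightarrow> ennreal" where
  "max_bandwidth H = (SUP h\<in>H. SUP i. ennreal (h $ i))"

end

(* For fixed y the estimator is a mean of n i.i.d. terms W_i with expectation m(y) = (K_h * f)(x, y), so its
   mean squared error is (m - f)^2 + (E W^2 - m^2) / n. Integrating over y and substituting t = x - s h turns
   the E W^2 term into the variance term of the claim, because f(t, .) has mass 1 for almost every t. The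
   remaining term is bounded by |m| <= F |K|_1 and int |m| <= |K|_1, which gives C1 = - F |K|_1^2; here f <= F
   applies because the support of K1 confines t to the box around x.
   For the asymptotic claim, the boxes eventually lie in the box for n = 1, which gives a bound F uniform in n,
   and fX x / fX (x - s h) - 1 is bounded below by a quantity tending to 0, by continuity of fX at x. *)
theory Submission
  imports Defs
begin

text \<open>Positivity of \<open>fX\<close> gives no bound on 1/\<open>fX\<close>, so the risk and
  the variance term may both be infinite. The bias-variance identity is therefore an equality of
  extended nonnegative integrals in which (1/n) int m^2 is added to the risk instead of being
  subtracted on the other side. That term is the one known to be finite, and it crosses the
  inequality only at the end, in the extended reals. The finiteness comes from an asymmetry between
  the first two moments. One factor 1/\<open>fX\<close> in W turns the joint density into the
  conditional density f, so the mean is controlled by F and |K|_1 alone, uniformly in n, h and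
  \<open>fX\<close>. In W^2 a second factor 1/\<open>fX\<close> survives, and it is the weight in
  the variance integral. In the asymptotic claim one o(1) has to serve all h in \<open>H n\<close>
  at once. This is why it is built as an infimum over h and over the cube containing the support of
  K1, and a lower bound on the risk needs only this one side of the density ratio.\<close>

section \<open>Squared norms and squared risk as extended integrals\<close>

lemma ennpowr_half_power2: "(ennpowr a (1/2))\<^sup>2 = a"
  by (cases a) (auto simp: ennpowr_def ennreal_power ennreal_top_eq_mult_iff power2_eq_square
      powr_half_sqrt ennreal_mult[symmetric])

lemma ennpowr_2: "ennpowr a 2 = a\<^sup>2"
  by (cases a) (auto simp: ennpowr_def ennreal_power ennreal_top_eq_mult_iff power2_eq_square
      powr_numeral ennreal_mult[symmetric])

lemma Lnorm_2_power2: "(Lnorm 2 g)\<^sup>2 = (\<integral>\<^sup>+ z. ennreal ((g z)\<^sup>2) \<partial>lborel)"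
  unfolding Lnorm_def ennpowr_half_power2 by simp

lemma Lnorm_1: "Lnorm 1 g = (\<integral>\<^sup>+ z. ennreal \<bar>g z\<bar> \<partial>lborel)"
  by (auto simp: Lnorm_def ennpowr_def ennreal_enn2real_if)

text \<open>For exponent 2 the inner and outer roots cancel against squares, which leaves an
  iterated integral to which Tonelli applies.\<close>

lemma risk_2_power2:
  "(risk M x f fhat 2)\<^sup>2 = (\<integral>\<^sup>+ \<omega>. \<integral>\<^sup>+ y. ennreal ((fhat \<omega> (x, y) - f (x, y))\<^sup>2) \<partial>lborel \<partial>M)"
  unfolding risk_def ennpowr_half_power2 ennpowr_2 section_norm_def Lnorm_2_power2 ..

section \<open>Changes of variables and products for Lebesgue measure\<close>

lemma nn_integral_lborel_vec_affine:
  fixes g :: "real ^ 'n::finite \<Rightarrow> ennreal"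
  assumes [measurable]: "g \<in> borel_measurable borel" and c: "\<And>i. c i \<noteq> 0"
  shows "(\<integral>\<^sup>+ t. g t \<partial>lborel) =
    ennreal (\<Prod>i\<in>UNIV. \<bar>c i\<bar>) * (\<integral>\<^sup>+ s. g (\<chi> i. a $ i + c i * s $ i) \<partial>lborel)"
proof -
  \<comment> \<open>The Euclidean change of variables takes its factors indexed by basis vectors.
    \<open>c'\<close> carries \<open>c\<close> over from coordinates, and \<open>THE\<close> is well
    defined because distinct coordinates have distinct axis vectors.\<close>
  define c' :: "real ^ 'n \<Rightarrow> real" where "c' b = c (THE i. b = axis i 1)" for b
  have c'_axis: "c' (axis i 1) = c i" for i
    unfolding c'_def by (rule arg_cong[where f=c]) (auto simp: axis_eq_axis)
  have Basis: "Basis = range (\<lambda>i::'n. axis i (1::real))"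
    by (auto simp: Basis_vec_def)
  have inj: "inj (\<lambda>i::'n. axis i (1::real))"
    by (auto simp: inj_on_def axis_eq_axis)
  have T: "a + (\<Sum>j\<in>Basis. (c' j * (s \<bullet> j)) *\<^sub>R j) = (\<chi> i. a $ i + c i * s $ i)" for s
  proof -
    have "(\<Sum>j\<in>Basis. (c' j * (s \<bullet> j)) *\<^sub>R j) = (\<Sum>i\<in>UNIV. (c i * s $ i) *\<^sub>R axis i 1)"
      unfolding Basis by (subst sum.reindex[OF inj]) (simp add: c'_axis inner_axis)
    also have "\<dots> = (\<chi> i. c i * s $ i)"
      by (subst basis_expansion[symmetric]) (simp add: scalar_mult_eq_scaleR)
    finally show ?thesis by (simp add: vec_eq_iff)
  qed
  have prod: "(\<Prod>j\<in>Basis. \<bar>c' j\<bar>) = (\<Prod>i\<in>UNIV. \<bar>c i\<bar>)"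
    unfolding Basis by (subst prod.reindex[OF inj]) (simp add: c'_axis)
  have "lborel = density (distr lborel borel (\<lambda>s. \<chi> i. a $ i + c i * s $ i))
      (\<lambda>_. ennreal (\<Prod>i\<in>UNIV. \<bar>c i\<bar>))"
    by (rule lborel_affine_euclidean[of c' a, unfolded T prod]) (auto simp: Basis c'_axis c)
  then have "(\<integral>\<^sup>+ t. g t \<partial>lborel) = (\<integral>\<^sup>+ t. g t \<partial>density
      (distr lborel borel (\<lambda>s. \<chi> i. a $ i + c i * s $ i)) (\<lambda>_. ennreal (\<Prod>i\<in>UNIV. \<bar>c i\<bar>)))"
    by (rule arg_cong)
  moreover have [measurable]: "(\<lambda>s. \<chi> i. a $ i + c i * s $ i) \<in> borel_measurable borel"
    by (intro borel_measurable_continuous_onI continuous_intros)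
  ultimately show ?thesis
    by (simp add: nn_integral_density nn_integral_distr nn_integral_cmult)
qed

text \<open>The affine rule with the negative factors \<open>- b i\<close>: the minus sign matches
  the argument x - t of the kernel, and the Jacobian keeps only the absolute values.\<close>

lemma nn_integral_lborel_vec_rescale:
  fixes g :: "real ^ 'n::finite \<Rightarrow> ennreal"
  assumes g: "g \<in> borel_measurable borel" and b: "\<And>i. 0 < b i"
  shows "(\<integral>\<^sup>+ t. g t \<partial>lborel) = ennreal (\<Prod>i\<in>UNIV. b i) * (\<integral>\<^sup>+ s. g (a - (\<chi> i. s $ i * b i)) \<partial>lborel)"
proof -
  have "(\<chi> i. a $ i + - b i * s $ i) = a - (\<chi> i. s $ i * b i)" for s
    by (simp add: vec_eq_iff)
  then show ?thesis
    using nn_integral_lborel_vec_affine[OF g, of "\<lambda>i. - b i" a] b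
    by (simp add: less_imp_neq[symmetric] less_imp_le)
qed

lemma nn_integral_lborel_vec_reflect:
  fixes g :: "real ^ 'n::finite \<Rightarrow> ennreal"
  assumes "g \<in> borel_measurable borel"
  shows "(\<integral>\<^sup>+ t. g (a - t) \<partial>lborel) = (\<integral>\<^sup>+ t. g t \<partial>lborel)"
  using nn_integral_lborel_vec_rescale[OF assms, of "\<lambda>_. 1" a] by simp

text \<open>A translation is the composition of two reflections, one about a and one about
  0.\<close>

lemma nn_integral_lborel_vec_translate:
  fixes g :: "real ^ 'n::finite \<Rightarrow> ennreal"
  assumes [measurable]: "g \<in> borel_measurable borel"
  shows "(\<integral>\<^sup>+ t. g (t - a) \<partial>lborel) = (\<integral>\<^sup>+ t. g t \<partial>lborel)"
  using nn_integral_lborel_vec_reflect[of "\<lambda>t. g (t - a)" a] nn_integral_lborel_vec_reflect[of g 0]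
  by simp

lemma nn_integral_lborel_pair:
  fixes g :: "'a::euclidean_space \<times> 'b::euclidean_space \<Rightarrow> ennreal"
  assumes "g \<in> borel_measurable borel"
  shows "(\<integral>\<^sup>+ z. g z \<partial>lborel) = (\<integral>\<^sup>+ t. \<integral>\<^sup>+ v. g (t, v) \<partial>lborel \<partial>lborel)"
  using assms by (subst lborel.nn_integral_fst) (auto simp: lborel_prod)

lemma measurable_fst_borel:
  fixes f :: "'c \<Rightarrow> 'a::second_countable_topology \<times> 'b::second_countable_topology"
  shows "f \<in> borel_measurable M \<Longrightarrow> (\<lambda>x. fst (f x)) \<in> borel_measurable M"
  unfolding borel_prod[symmetric] by measurable

lemma measurable_snd_borel:
  fixes f :: "'c \<Rightarrow> 'a::second_countable_topology \<times> 'b::second_countable_topology"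
  shows "f \<in> borel_measurable M \<Longrightarrow> (\<lambda>x. snd (f x)) \<in> borel_measurable M"
  unfolding borel_prod[symmetric] by measurable

lemma nn_integral_lborel_pair_mult:
  fixes a :: "'a::euclidean_space \<Rightarrow> ennreal" and b :: "'b::euclidean_space \<Rightarrow> ennreal"
  assumes [measurable]: "a \<in> borel_measurable borel" "b \<in> borel_measurable borel"
  shows "(\<integral>\<^sup>+ z. a (fst z) * b (snd z) \<partial>lborel) = (\<integral>\<^sup>+ t. a t \<partial>lborel) * (\<integral>\<^sup>+ v. b v \<partial>lborel)"
proof -
  note [measurable] = measurable_fst_borel measurable_snd_borel
  have "(\<integral>\<^sup>+ z. a (fst z) * b (snd z) \<partial>lborel) = (\<integral>\<^sup>+ t. \<integral>\<^sup>+ v. a t * b v \<partial>lborel \<partial>lborel)"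
    by (subst nn_integral_lborel_pair) auto
  then show ?thesis
    by (simp add: nn_integral_cmult nn_integral_multc)
qed

section \<open>Second moments of sums of independent variables\<close>

context prob_space
begin

text \<open>
  The second moments below may be infinite: the estimator need not be square integrable, since
  \<open>fX\<close> is not bounded away from \<open>0\<close>.
\<close>

lemma nn_integral_power2_shift:
  assumes int: "integrable M U" and mean: "expectation U = 0"
  shows "(\<integral>\<^sup>+ \<omega>. ennreal ((U \<omega> + c)\<^sup>2) \<partial>M) = (\<integral>\<^sup>+ \<omega>. ennreal ((U \<omega>)\<^sup>2) \<partial>M) + ennreal (c\<^sup>2)"
proof (cases "integrable M (\<lambda>\<omega>. (U \<omega>)\<^sup>2)")
  case True
  have eq: "(U \<omega> + c)\<^sup>2 = (U \<omega>)\<^sup>2 + (2 * c) * U \<omega> + c\<^sup>2" for \<omega>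
    by (simp add: power2_eq_square algebra_simps)
  have "integrable M (\<lambda>\<omega>. (U \<omega> + c)\<^sup>2)"
    unfolding eq using True int by auto
  moreover have "expectation (\<lambda>\<omega>. (U \<omega> + c)\<^sup>2) = expectation (\<lambda>\<omega>. (U \<omega>)\<^sup>2) + c\<^sup>2"
    unfolding eq using True int mean by (simp add: prob_space)
  ultimately show ?thesis
    using True by (simp add: nn_integral_eq_integral ennreal_plus)
next
  case False
  have [measurable]: "U \<in> borel_measurable M" using int by simp
  \<comment> \<open>Both sides are infinite in this case: the squares of U + c and of U differ by an
    affine function of U, which is integrable.\<close>
  have "\<not> integrable M (\<lambda>\<omega>. (U \<omega> + c)\<^sup>2)"
  proof
    assume "integrable M (\<lambda>\<omega>. (U \<omega> + c)\<^sup>2)"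
    then have "integrable M (\<lambda>\<omega>. (U \<omega> + c)\<^sup>2 - (2 * c) * U \<omega> - c\<^sup>2)"
      using int by auto
    also have "(\<lambda>\<omega>. (U \<omega> + c)\<^sup>2 - (2 * c) * U \<omega> - c\<^sup>2) = (\<lambda>\<omega>. (U \<omega>)\<^sup>2)"
      by (auto simp: power2_eq_square algebra_simps)
    finally show False using False by simp
  qed
  with False show ?thesis
    by (simp add: integrable_iff_bounded top.not_eq_extremum[symmetric])
qed

text \<open>By independence the joint law is a product, so V can be frozen at a value v. The shift
  by the constant v then kills the cross term because U is centred. Nothing but measurability is
  asked of V, so it can absorb both the remaining summands and a constant.\<close>

lemma nn_integral_power2_indep_add:
  assumes indep: "indep_var borel U borel V"
    and int: "integrable M U" and mean: "expectation U = 0"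
  shows "(\<integral>\<^sup>+ \<omega>. ennreal ((U \<omega> + V \<omega>)\<^sup>2) \<partial>M) =
    (\<integral>\<^sup>+ \<omega>. ennreal ((U \<omega>)\<^sup>2) \<partial>M) + (\<integral>\<^sup>+ \<omega>. ennreal ((V \<omega>)\<^sup>2) \<partial>M)"
proof -
  have [measurable]: "U \<in> borel_measurable M" "V \<in> borel_measurable M"
    and joint: "distr M borel U \<Otimes>\<^sub>M distr M borel V = distr M (borel \<Otimes>\<^sub>M borel) (\<lambda>\<omega>. (U \<omega>, V \<omega>))"
    using indep by (auto simp: indep_var_distribution_eq)
  interpret DU: prob_space "distr M borel U" by (rule prob_space_distr) simp
  interpret DV: prob_space "distr M borel V" by (rule prob_space_distr) simp
  interpret P: pair_prob_space "distr M borel U" "distr M borel V" ..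
  have "(\<integral>\<^sup>+ \<omega>. ennreal ((U \<omega> + V \<omega>)\<^sup>2) \<partial>M) =
      (\<integral>\<^sup>+ z. ennreal ((fst z + snd z)\<^sup>2) \<partial>(distr M borel U \<Otimes>\<^sub>M distr M borel V))"
    unfolding joint by (subst nn_integral_distr) auto
  also have "\<dots> = (\<integral>\<^sup>+ v. \<integral>\<^sup>+ u. ennreal ((u + v)\<^sup>2) \<partial>distr M borel U \<partial>distr M borel V)"
    by (subst P.nn_integral_snd[symmetric]) auto
  also have "\<dots> = (\<integral>\<^sup>+ v. (\<integral>\<^sup>+ \<omega>. ennreal ((U \<omega>)\<^sup>2) \<partial>M) + ennreal (v\<^sup>2) \<partial>distr M borel V)"
    using nn_integral_power2_shift[OF int mean]
    by (intro nn_integral_cong) (simp add: nn_integral_distr)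
  also have "\<dots> = (\<integral>\<^sup>+ \<omega>. ennreal ((U \<omega>)\<^sup>2) \<partial>M) + (\<integral>\<^sup>+ \<omega>. ennreal ((V \<omega>)\<^sup>2) \<partial>M)"
    by (subst nn_integral_add) (auto simp: nn_integral_distr DV.emeasure_space_1[simplified] emeasure_space_1)
  finally show ?thesis .
qed

text \<open>In the induction the new summand plays the centred variable U, and the old sum together
  with c plays V.\<close>

lemma nn_integral_power2_indep_sum:
  fixes U :: "'i \<Rightarrow> 'a \<Rightarrow> real"
  assumes "finite I" "indep_vars (\<lambda>_. borel) U I"
    and "\<And>i. i \<in> I \<Longrightarrow> integrable M (U i)" "\<And>i. i \<in> I \<Longrightarrow> expectation (U i) = 0"
  shows "(\<integral>\<^sup>+ \<omega>. ennreal (((\<Sum>i\<in>I. U i \<omega>) + c)\<^sup>2) \<partial>M) =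
    (\<Sum>i\<in>I. \<integral>\<^sup>+ \<omega>. ennreal ((U i \<omega>)\<^sup>2) \<partial>M) + ennreal (c\<^sup>2)"
  using assms
proof (induction I rule: finite_induct)
  case empty
  then show ?case by (simp add: emeasure_space_1)
next
  case (insert i I)
  have "indep_var borel (U i) borel (\<lambda>\<omega>. \<Sum>i\<in>I. U i \<omega>)"
    using insert by (intro indep_vars_sum) auto
  then have "indep_var borel ((\<lambda>z. z) \<circ> U i) borel ((\<lambda>z. z + c) \<circ> (\<lambda>\<omega>. \<Sum>i\<in>I. U i \<omega>))"
    by (rule indep_var_compose) auto
  then have ind: "indep_var borel (U i) borel (\<lambda>\<omega>. (\<Sum>i\<in>I. U i \<omega>) + c)"
    by (simp add: comp_def)
  have "(\<integral>\<^sup>+ \<omega>. ennreal (((\<Sum>i\<in>I. U i \<omega>) + c)\<^sup>2) \<partial>M) =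
    (\<Sum>i\<in>I. \<integral>\<^sup>+ \<omega>. ennreal ((U i \<omega>)\<^sup>2) \<partial>M) + ennreal (c\<^sup>2)"
    using insert.prems by (intro insert.IH) (auto intro: indep_vars_subset)
  with nn_integral_power2_indep_add[OF ind] insert show ?case
    by (simp add: add.assoc)
qed

text \<open>The error is split as the sum of the centred terms (Z i - m)/n plus the constant m - c.
  Each term contributes v/n^2, hence v/n in total, and v + m^2 = s. Adding m^2/n on the left avoids
  a difference involving s, which may be infinite.\<close>

lemma nn_integral_power2_mean_diff:
  fixes Z :: "nat \<Rightarrow> 'a \<Rightarrow> real"
  assumes n: "n \<ge> 1" and indep: "indep_vars (\<lambda>_. borel) Z {1..n}"
    and int: "\<And>i. i \<in> {1..n} \<Longrightarrow> integrable M (Z i)"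
    and mean: "\<And>i. i \<in> {1..n} \<Longrightarrow> expectation (Z i) = m"
    and mom: "\<And>i. i \<in> {1..n} \<Longrightarrow> (\<integral>\<^sup>+ \<omega>. ennreal ((Z i \<omega>)\<^sup>2) \<partial>M) = s"
  shows "(\<integral>\<^sup>+ \<omega>. ennreal ((1 / real n * (\<Sum>i=1..n. Z i \<omega>) - c)\<^sup>2) \<partial>M) + ennreal (1 / real n) * ennreal (m\<^sup>2) =
    ennreal ((m - c)\<^sup>2) + ennreal (1 / real n) * s"
proof -
  \<comment> \<open>The common variance. Index 1 is available because n >= 1, and the other
    variances agree with it after cancelling the finite term m^2.\<close>
  define v where "v = (\<integral>\<^sup>+ \<omega>. ennreal ((Z 1 \<omega> - m)\<^sup>2) \<partial>M)"
  have cent: "(\<integral>\<^sup>+ \<omega>. ennreal ((Z i \<omega> - m)\<^sup>2) \<partial>M) + ennreal (m\<^sup>2) = s" if "i \<in> {1..n}" for i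
    using nn_integral_power2_shift[of "\<lambda>\<omega>. Z i \<omega> - m" m] int[OF that] mean[OF that] mom[OF that]
    by (simp add: prob_space)
  have v: "(\<integral>\<^sup>+ \<omega>. ennreal ((Z i \<omega> - m)\<^sup>2) \<partial>M) = v" if "i \<in> {1..n}" for i
  proof -
    have "(\<integral>\<^sup>+ \<omega>. ennreal ((Z i \<omega> - m)\<^sup>2) \<partial>M) + ennreal (m\<^sup>2) = v + ennreal (m\<^sup>2)"
      using cent[OF that] cent[of 1] n by (simp add: v_def)
    then show ?thesis
      by (simp add: add.commute[of _ "ennreal (m\<^sup>2)"] ennreal_add_left_cancel)
  qed
  have Zm[measurable]: "Z i \<in> borel_measurable M" if "i \<in> {1..n}" for i
    using int[OF that] by simp
  have U: "(\<integral>\<^sup>+ \<omega>. ennreal (((Z i \<omega> - m) / real n)\<^sup>2) \<partial>M) = ennreal (1 / (real n)\<^sup>2) * v"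
    if i: "i \<in> {1..n}" for i
  proof -
    have "ennreal (((Z i \<omega> - m) / real n)\<^sup>2) = ennreal (1 / (real n)\<^sup>2) * ennreal ((Z i \<omega> - m)\<^sup>2)" for \<omega>
      by (simp add: power_divide ennreal_mult[symmetric])
    then show ?thesis
      using Zm[OF i] by (simp add: nn_integral_cmult v[OF i])
  qed
  have "indep_vars (\<lambda>_. borel) (\<lambda>i \<omega>. (Z i \<omega> - m) / real n) {1..n}"
    by (rule indep_vars_compose2[OF indep, of "\<lambda>_ z. (z - m) / real n"]) auto
  then have "(\<integral>\<^sup>+ \<omega>. ennreal (((\<Sum>i=1..n. (Z i \<omega> - m) / real n) + (m - c))\<^sup>2) \<partial>M) =
      (\<Sum>i=1..n. \<integral>\<^sup>+ \<omega>. ennreal (((Z i \<omega> - m) / real n)\<^sup>2) \<partial>M) + ennreal ((m - c)\<^sup>2)"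
    using int mean by (intro nn_integral_power2_indep_sum) (auto simp: prob_space)
  also have "(\<Sum>i=1..n. \<integral>\<^sup>+ \<omega>. ennreal (((Z i \<omega> - m) / real n)\<^sup>2) \<partial>M) = ennreal (1 / real n) * v"
  proof -
    have "(\<Sum>i=1..n. \<integral>\<^sup>+ \<omega>. ennreal (((Z i \<omega> - m) / real n)\<^sup>2) \<partial>M) = of_nat n * (ennreal (1 / (real n)\<^sup>2) * v)"
      by (simp add: U)
    also have "\<dots> = ennreal (1 / real n) * v"
      using n by (simp add: mult.assoc[symmetric] ennreal_of_nat_eq_real_of_nat ennreal_mult[symmetric]
          power2_eq_square)
    finally show ?thesis .
  qed
  also have "(\<lambda>\<omega>. ennreal (((\<Sum>i=1..n. (Z i \<omega> - m) / real n) + (m - c))\<^sup>2)) =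
      (\<lambda>\<omega>. ennreal ((1 / real n * (\<Sum>i=1..n. Z i \<omega>) - c)\<^sup>2))"
    using n by (simp add: sum_divide_distrib[symmetric] sum_subtractf diff_divide_distrib)
  finally have eq: "(\<integral>\<^sup>+ \<omega>. ennreal ((1 / real n * (\<Sum>i=1..n. Z i \<omega>) - c)\<^sup>2) \<partial>M) =
      ennreal (1 / real n) * v + ennreal ((m - c)\<^sup>2)" .
  have "v + ennreal (m\<^sup>2) = s"
    using cent[of 1] v[of 1] n by simp
  then have "ennreal (1 / real n) * s = ennreal (1 / real n) * v + ennreal (1 / real n) * ennreal (m\<^sup>2)"
    by (simp add: distrib_left[symmetric])
  then show ?thesis
    unfolding eq by (simp add: ac_simps)
qed

end

section \<open>Risk for one fixed bandwidth and a product kernel\<close>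

lemma prod_UNIV_sum:
  fixes g :: "'a::finite + 'b::finite \<Rightarrow> real"
  shows "(\<Prod>i\<in>UNIV. g i) = (\<Prod>i\<in>UNIV. g (Inl i)) * (\<Prod>j\<in>UNIV. g (Inr j))"
  by (subst UNIV_Plus_UNIV[symmetric], subst prod.Plus) auto

text \<open>One bandwidth is fixed. The support of K1 and the box around x enter only through
  \<open>cond_density_le\<close>, which bounds f just where the kernel does not vanish. The marginal
  identity is an almost-everywhere statement because densities are determined only up to null
  sets.\<close>

locale product_kernel =
  fixes K1 :: "real ^ 'a::finite \<Rightarrow> real" and K2 :: "real ^ 'b::finite \<Rightarrow> real"
    and h :: "real ^ ('a + 'b)"
    and fXY :: "(real ^ 'a) \<times> (real ^ 'b) \<Rightarrow> real" and fX :: "real ^ 'a \<Rightarrow> real"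
    and x :: "real ^ 'a" and F :: real
  assumes K1_measurable [measurable]: "K1 \<in> borel_measurable borel"
    and K2_measurable [measurable]: "K2 \<in> borel_measurable borel"
    and h_pos: "0 < h $ i"
    and fXY_measurable [measurable]: "fXY \<in> borel_measurable borel"
    and fXY_nonneg: "0 \<le> fXY z"
    and fX_measurable [measurable]: "fX \<in> borel_measurable borel"
    and fX_pos: "0 < fX t"
    and fX_marginal: "AE t in lborel. ennreal (fX t) = (\<integral>\<^sup>+ v. ennreal (fXY (t, v)) \<partial>lborel)"
    and cond_density_le: "K1 (\<chi> i. (x - t) $ i / h $ Inl i) \<noteq> 0 \<Longrightarrow> cond_density fXY fX (t, v) \<le> F"
    and F_nonneg: "0 \<le> F"
    and L1_finite: "(\<integral>\<^sup>+ u. ennreal \<bar>K1 u\<bar> \<partial>lborel) * (\<integral>\<^sup>+ v. ennreal \<bar>K2 v\<bar> \<partial>lborel) < \<infinity>"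
begin

declare measurable_fst_borel [measurable] measurable_snd_borel [measurable]

abbreviation f where "f \<equiv> cond_density fXY fX"

abbreviation K where "K \<equiv> \<lambda>(u, v). K1 u * K2 v"

abbreviation norm1 where
  "norm1 \<equiv> (\<integral>\<^sup>+ u. ennreal \<bar>K1 u\<bar> \<partial>lborel) * (\<integral>\<^sup>+ v. ennreal \<bar>K2 v\<bar> \<partial>lborel)"

definition K1h where "K1h u = K1 (\<chi> i. u $ i / h $ Inl i) / (\<Prod>i\<in>UNIV. h $ Inl i)"

definition K2h where "K2h v = K2 (\<chi> j. v $ j / h $ Inr j) / (\<Prod>j\<in>UNIV. h $ Inr j)"

lemma K1h_measurable [measurable]: "K1h \<in> borel_measurable borel"
proof -
  have [measurable]: "(\<lambda>u::real ^ 'a. \<chi> i. u $ i / h $ Inl i) \<in> borel_measurable borel"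
    by (intro borel_measurable_continuous_onI continuous_intros) (simp add: h_pos less_imp_neq[symmetric])
  show ?thesis unfolding K1h_def[abs_def] by measurable
qed

lemma K2h_measurable [measurable]: "K2h \<in> borel_measurable borel"
proof -
  have [measurable]: "(\<lambda>v::real ^ 'b. \<chi> j. v $ j / h $ Inr j) \<in> borel_measurable borel"
    by (intro borel_measurable_continuous_onI continuous_intros) (simp add: h_pos less_imp_neq[symmetric])
  show ?thesis unfolding K2h_def[abs_def] by measurable
qed

lemma rescale_measurable [measurable]:
  "(\<lambda>s::real ^ 'a. \<chi> i. s $ i * h $ Inl i) \<in> borel_measurable borel"
  by (intro borel_measurable_continuous_onI continuous_intros)

lemma f_eq: "f z = fXY z / fX (fst z)"
  by (simp add: cond_density_def split_beta)

lemma f_measurable [measurable]: "f \<in> borel_measurable borel"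
proof -
  have "(\<lambda>z. fXY z / fX (fst z)) \<in> borel_measurable borel"
    by measurable
  then show ?thesis by (simp add: f_eq[abs_def])
qed

lemma f_nonneg: "0 \<le> f z"
  using fXY_nonneg[of z] fX_pos[of "fst z"] by (simp add: f_eq less_imp_le)

lemma K1h_neq_0_imp_f_le: "K1h (x - t) \<noteq> 0 \<Longrightarrow> f (t, v) \<le> F"
  using cond_density_le[of t v] by (auto simp: K1h_def)

lemma scaled_kernel_eq: "scaled_kernel K h (u, v) = K1h u * K2h v"
  by (simp add: scaled_kernel_def K1h_def K2h_def prod_UNIV_sum)

lemma prod_h_pos: "0 < (\<Prod>i\<in>UNIV. h $ Inl i)" "0 < (\<Prod>j\<in>UNIV. h $ Inr j)"
  by (auto intro!: prod_pos h_pos)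

lemma K1h_rescale: "K1h (\<chi> i. s $ i * h $ Inl i) = K1 s / (\<Prod>i\<in>UNIV. h $ Inl i)"
  using h_pos by (simp add: K1h_def less_imp_neq[symmetric])

lemma K2h_rescale: "K2h (\<chi> i. s $ i * h $ Inr i) = K2 s / (\<Prod>j\<in>UNIV. h $ Inr j)"
  using h_pos by (simp add: K2h_def less_imp_neq[symmetric])

lemma nn_integral_K1h_abs: "(\<integral>\<^sup>+ t. ennreal \<bar>K1h (x - t)\<bar> \<partial>lborel) = (\<integral>\<^sup>+ u. ennreal \<bar>K1 u\<bar> \<partial>lborel)"
proof -
  let ?P = "\<Prod>i\<in>UNIV. h $ Inl i"
  have "(\<integral>\<^sup>+ t. ennreal \<bar>K1h (x - t)\<bar> \<partial>lborel) = ennreal ?P * (\<integral>\<^sup>+ s. ennreal \<bar>K1 s / ?P\<bar> \<partial>lborel)"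
    by (subst nn_integral_lborel_vec_rescale[where a = x and b = "\<lambda>i. h $ Inl i"])
      (auto simp: h_pos K1h_rescale)
  also have "\<dots> = (\<integral>\<^sup>+ u. ennreal \<bar>K1 u\<bar> \<partial>lborel)"
    using prod_h_pos(1) by (subst nn_integral_cmult[symmetric])
      (auto simp: abs_divide ennreal_mult[symmetric] h_pos[THEN less_imp_neq, symmetric] simp del: abs_prod)
  finally show ?thesis .
qed

text \<open>Squaring the normalisation gives 1/P^2 and the Jacobian gives back P, so a single factor
  1/P remains.\<close>

lemma nn_integral_K1h_power2:
  "(\<integral>\<^sup>+ t. ennreal ((K1h (x - t))\<^sup>2 / fX t) \<partial>lborel) = ennreal (1 / (\<Prod>i\<in>UNIV. h $ Inl i)) *
    (\<integral>\<^sup>+ s. ennreal ((K1 s)\<^sup>2 / fX (x - (\<chi> i. s $ i * h $ Inl i))) \<partial>lborel)"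
proof -
  let ?P = "\<Prod>i\<in>UNIV. h $ Inl i"
  have "(\<integral>\<^sup>+ t. ennreal ((K1h (x - t))\<^sup>2 / fX t) \<partial>lborel) =
      ennreal ?P * (\<integral>\<^sup>+ s. ennreal ((K1 s / ?P)\<^sup>2 / fX (x - (\<chi> i. s $ i * h $ Inl i))) \<partial>lborel)"
    by (subst nn_integral_lborel_vec_rescale[where a = x and b = "\<lambda>i. h $ Inl i"])
      (auto simp: h_pos K1h_rescale)
  also have "\<dots> = (\<integral>\<^sup>+ s. ennreal (1 / ?P) * ennreal ((K1 s)\<^sup>2 / fX (x - (\<chi> i. s $ i * h $ Inl i))) \<partial>lborel)"
    using prod_h_pos(1) fX_pos[THEN less_imp_le] by (subst nn_integral_cmult[symmetric])
      (auto simp: ennreal_mult[symmetric] power_divide power2_eq_square intro!: nn_integral_cong)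
  also have "\<dots> = ennreal (1 / ?P) *
      (\<integral>\<^sup>+ s. ennreal ((K1 s)\<^sup>2 / fX (x - (\<chi> i. s $ i * h $ Inl i))) \<partial>lborel)"
    by (rule nn_integral_cmult) measurable
  finally show ?thesis .
qed

lemma nn_integral_K2h_abs: "(\<integral>\<^sup>+ w. ennreal \<bar>K2h w\<bar> \<partial>lborel) = (\<integral>\<^sup>+ v. ennreal \<bar>K2 v\<bar> \<partial>lborel)"
proof -
  let ?P = "\<Prod>j\<in>UNIV. h $ Inr j"
  have "(\<integral>\<^sup>+ w. ennreal \<bar>K2h w\<bar> \<partial>lborel) = (\<integral>\<^sup>+ w. ennreal \<bar>K2h (0 - w)\<bar> \<partial>lborel)"
    by (rule nn_integral_lborel_vec_reflect[symmetric]) measurable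
  also have "\<dots> = ennreal ?P * (\<integral>\<^sup>+ s. ennreal \<bar>K2 s / ?P\<bar> \<partial>lborel)"
    by (subst nn_integral_lborel_vec_rescale[where a = 0 and b = "\<lambda>i. h $ Inr i"])
      (auto simp: h_pos K2h_rescale)
  also have "\<dots> = (\<integral>\<^sup>+ u. ennreal \<bar>K2 u\<bar> \<partial>lborel)"
    using prod_h_pos(2) by (subst nn_integral_cmult[symmetric])
      (auto simp: abs_divide ennreal_mult[symmetric] h_pos[THEN less_imp_neq, symmetric] simp del: abs_prod)
  finally show ?thesis .
qed

lemma nn_integral_K2h_power2:
  "(\<integral>\<^sup>+ w. ennreal ((K2h w)\<^sup>2) \<partial>lborel) =
    ennreal (1 / (\<Prod>j\<in>UNIV. h $ Inr j)) * (\<integral>\<^sup>+ v. ennreal ((K2 v)\<^sup>2) \<partial>lborel)"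
proof -
  let ?P = "\<Prod>j\<in>UNIV. h $ Inr j"
  have "(\<integral>\<^sup>+ w. ennreal ((K2h w)\<^sup>2) \<partial>lborel) = (\<integral>\<^sup>+ w. ennreal ((K2h (0 - w))\<^sup>2) \<partial>lborel)"
    by (rule nn_integral_lborel_vec_reflect[symmetric]) measurable
  also have "\<dots> = ennreal ?P * (\<integral>\<^sup>+ s. ennreal ((K2 s / ?P)\<^sup>2) \<partial>lborel)"
    by (subst nn_integral_lborel_vec_rescale[where a = 0 and b = "\<lambda>i. h $ Inr i"])
      (auto simp: h_pos K2h_rescale)
  also have "\<dots> = (\<integral>\<^sup>+ s. ennreal (1 / ?P) * ennreal ((K2 s)\<^sup>2) \<partial>lborel)"
    using prod_h_pos(2) by (subst nn_integral_cmult[symmetric])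
      (auto simp: ennreal_mult[symmetric] power_divide power2_eq_square intro!: nn_integral_cong)
  also have "\<dots> = ennreal (1 / ?P) * (\<integral>\<^sup>+ v. ennreal ((K2 v)\<^sup>2) \<partial>lborel)"
    by (rule nn_integral_cmult) measurable
  finally show ?thesis .
qed

text \<open>An exceptional null set of t is harmless, since the mass is only used inside an integral
  over t.\<close>

lemma f_section_mass: "AE t in lborel. (\<integral>\<^sup>+ v. ennreal (f (t, v)) \<partial>lborel) = 1"
  using fX_marginal
proof eventually_elim
  case (elim t)
  have "(\<integral>\<^sup>+ v. ennreal (f (t, v)) \<partial>lborel) = (\<integral>\<^sup>+ v. ennreal (1 / fX t) * ennreal (fXY (t, v)) \<partial>lborel)"
    using fX_pos[of t] fXY_nonneg by (simp add: f_eq ennreal_mult[symmetric])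
  also have "\<dots> = ennreal (1 / fX t) * ennreal (fX t)"
    unfolding elim by (rule nn_integral_cmult) measurable
  also have "\<dots> = 1"
    using fX_pos[of t] by (simp add: ennreal_mult[symmetric] less_imp_neq[symmetric])
  finally show ?case .
qed

text \<open>Integrating over y first, translation invariance detaches b from z; then f(t, .) has
  mass 1. With absolute values of the kernel factors this gives the L1 bound on the mean, and with
  their squares and the weight 1/\<open>fX\<close> it gives the variance term.\<close>

lemma nn_integral_conv_f:
  fixes a :: "real ^ 'a \<Rightarrow> ennreal" and b :: "real ^ 'b \<Rightarrow> ennreal"
  assumes [measurable]: "a \<in> borel_measurable borel" "b \<in> borel_measurable borel"
  shows "(\<integral>\<^sup>+ y. \<integral>\<^sup>+ z. a (fst z) * b (y - snd z) * ennreal (f z) \<partial>lborel \<partial>lborel) =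
    (\<integral>\<^sup>+ t. a t \<partial>lborel) * (\<integral>\<^sup>+ w. b w \<partial>lborel)"
proof -
  let ?B = "\<integral>\<^sup>+ w. b w \<partial>lborel"
  have "(\<integral>\<^sup>+ y. \<integral>\<^sup>+ z. a (fst z) * b (y - snd z) * ennreal (f z) \<partial>lborel \<partial>lborel) =
      (\<integral>\<^sup>+ z. \<integral>\<^sup>+ y. a (fst z) * b (y - snd z) * ennreal (f z) \<partial>lborel \<partial>lborel)"
    by (rule lborel_pair.Fubini'[symmetric]) measurable
  also have "\<dots> = (\<integral>\<^sup>+ z. ?B * (a (fst z) * ennreal (f z)) \<partial>lborel)"
  proof (rule nn_integral_cong)
    fix z :: "(real ^ 'a) \<times> (real ^ 'b)"
    have "(\<integral>\<^sup>+ y. a (fst z) * b (y - snd z) * ennreal (f z) \<partial>lborel) =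
        (\<integral>\<^sup>+ y. (a (fst z) * ennreal (f z)) * b (y - snd z) \<partial>lborel)"
      by (simp add: ac_simps)
    also have "\<dots> = (a (fst z) * ennreal (f z)) * (\<integral>\<^sup>+ y. b (y - snd z) \<partial>lborel)"
      by (rule nn_integral_cmult) measurable
    finally show "(\<integral>\<^sup>+ y. a (fst z) * b (y - snd z) * ennreal (f z) \<partial>lborel) = ?B * (a (fst z) * ennreal (f z))"
      by (simp add: nn_integral_lborel_vec_translate ac_simps)
  qed
  also have "\<dots> = ?B * (\<integral>\<^sup>+ z. a (fst z) * ennreal (f z) \<partial>lborel)"
    by (rule nn_integral_cmult) measurable
  also have "(\<integral>\<^sup>+ z. a (fst z) * ennreal (f z) \<partial>lborel) = (\<integral>\<^sup>+ t. \<integral>\<^sup>+ v. a t * ennreal (f (t, v)) \<partial>lborel \<partial>lborel)"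
    by (subst nn_integral_lborel_pair) auto
  also have "\<dots> = (\<integral>\<^sup>+ t. a t * (\<integral>\<^sup>+ v. ennreal (f (t, v)) \<partial>lborel) \<partial>lborel)"
    by (intro nn_integral_cong nn_integral_cmult) measurable
  also have "\<dots> = (\<integral>\<^sup>+ t. a t \<partial>lborel)"
    using f_section_mass by (intro nn_integral_cong_AE) auto
  finally show ?thesis by (simp add: ac_simps)
qed

text \<open>The convolution at (x, y) with the kernel replaced by its absolute value. It dominates
  |m y| and is also the absolute first moment of a single summand of the estimator.\<close>

definition abs_conv :: "real ^ 'b \<Rightarrow> ennreal" where
  "abs_conv y = (\<integral>\<^sup>+ z. ennreal \<bar>K1h (x - fst z)\<bar> * ennreal \<bar>K2h (y - snd z)\<bar> * ennreal (f z) \<partial>lborel)"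

lemma abs_conv_measurable [measurable]: "abs_conv \<in> borel_measurable borel"
  unfolding abs_conv_def by measurable

lemma nn_integral_abs_conv: "(\<integral>\<^sup>+ y. abs_conv y \<partial>lborel) = norm1"
  unfolding abs_conv_def
  by (subst nn_integral_conv_f) (auto simp: nn_integral_K1h_abs nn_integral_K2h_abs)

lemma abs_conv_le: "abs_conv y \<le> ennreal F * norm1"
proof -
  have "abs_conv y \<le>
      (\<integral>\<^sup>+ z. ennreal F * (ennreal \<bar>K1h (x - fst z)\<bar> * ennreal \<bar>K2h (y - snd z)\<bar>) \<partial>lborel)"
    unfolding abs_conv_def
  proof (rule nn_integral_mono)
    fix z :: "(real ^ 'a) \<times> (real ^ 'b)"
    show "ennreal \<bar>K1h (x - fst z)\<bar> * ennreal \<bar>K2h (y - snd z)\<bar> * ennreal (f z) \<le>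
        ennreal F * (ennreal \<bar>K1h (x - fst z)\<bar> * ennreal \<bar>K2h (y - snd z)\<bar>)"
      \<comment> \<open>Where \<open>K1h\<close> vanishes both sides are 0; elsewhere f is at most
        F.\<close>
      using K1h_neq_0_imp_f_le[of "fst z" "snd z"]
      by (cases "K1h (x - fst z) = 0") (auto simp: mult.commute[of _ "ennreal (f z)"] intro!: mult_right_mono ennreal_leI)
  qed
  also have "\<dots> = ennreal F * (\<integral>\<^sup>+ z. ennreal \<bar>K1h (x - fst z)\<bar> * ennreal \<bar>K2h (y - snd z)\<bar> \<partial>lborel)"
    by (rule nn_integral_cmult) measurable
  also have "(\<integral>\<^sup>+ z. ennreal \<bar>K1h (x - fst z)\<bar> * ennreal \<bar>K2h (y - snd z)\<bar> \<partial>lborel) = norm1"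
    using nn_integral_lborel_vec_reflect[of "\<lambda>v. ennreal \<bar>K2h v\<bar>" y]
      nn_integral_lborel_pair_mult[of "\<lambda>t. ennreal \<bar>K1h (x - t)\<bar>" "\<lambda>v. ennreal \<bar>K2h (y - v)\<bar>"]
    by (simp add: nn_integral_K1h_abs nn_integral_K2h_abs)
  finally show ?thesis .
qed

lemma abs_conv_finite: "abs_conv y < \<infinity>"
  using abs_conv_le[of y] L1_finite by (simp add: ennreal_mult_less_top le_less_trans)

abbreviation m where "m y \<equiv> conv (scaled_kernel K h) f (x, y)"

lemma m_eq: "m y = (LINT z|lborel. K1h (x - fst z) * K2h (y - snd z) * f z)"
  by (auto simp: conv_def scaled_kernel_eq minus_prod_def intro!: Bochner_Integration.integral_cong)

lemma m_measurable [measurable]: "m \<in> borel_measurable borel"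
  unfolding m_eq by measurable

lemma abs_m_le: "ennreal \<bar>m y\<bar> \<le> abs_conv y"
proof -
  have "ennreal (norm (m y)) \<le> (\<integral>\<^sup>+ z. ennreal (norm (K1h (x - fst z) * K2h (y - snd z) * f z)) \<partial>lborel)"
    unfolding m_eq
    \<comment> \<open>A Bochner integral without integrability has the default value 0, for which
      the bound is trivial.\<close>
    by (cases "integrable lborel (\<lambda>z. K1h (x - fst z) * K2h (y - snd z) * f z)")
      (rule integral_norm_bound_ennreal, auto simp: not_integrable_integral_eq)
  also have "\<dots> = abs_conv y"
    unfolding abs_conv_def
    by (intro nn_integral_cong) (simp add: abs_mult f_nonneg ennreal_mult)
  finally show ?thesis by simp
qed

text \<open>Only one of the two factors |m y| is replaced by its uniform bound; the other is
  integrated. Hence F appears to the first power and the L1 norm to the second.\<close>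

lemma nn_integral_m_power2_le: "(\<integral>\<^sup>+ y. ennreal ((m y)\<^sup>2) \<partial>lborel) \<le> ennreal F * norm1\<^sup>2"
proof -
  have "(\<integral>\<^sup>+ y. ennreal ((m y)\<^sup>2) \<partial>lborel) \<le> (\<integral>\<^sup>+ y. (ennreal F * norm1) * abs_conv y \<partial>lborel)"
  proof (rule nn_integral_mono)
    fix y
    have "ennreal ((m y)\<^sup>2) = ennreal \<bar>m y\<bar> * ennreal \<bar>m y\<bar>"
      by (simp add: ennreal_mult[symmetric] power2_eq_square)
    also have "\<dots> \<le> (ennreal F * norm1) * abs_conv y"
      using abs_m_le[of y] abs_conv_le[of y] by (intro mult_mono) (auto intro: order_trans)
    finally show "ennreal ((m y)\<^sup>2) \<le> (ennreal F * norm1) * abs_conv y" .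
  qed
  also have "\<dots> = (ennreal F * norm1) * (\<integral>\<^sup>+ y. abs_conv y \<partial>lborel)"
    by (rule nn_integral_cmult) measurable
  finally show ?thesis
    by (simp add: nn_integral_abs_conv power2_eq_square ac_simps)
qed

text \<open>The contribution of one observation z to the estimator at (x, y), before
  averaging.\<close>

definition W where "W y z = 1 / fX (fst z) * (K1h (x - fst z) * K2h (y - snd z))"

lemma W_measurable [measurable]: "(\<lambda>(y, z). W y z) \<in> borel_measurable (borel \<Otimes>\<^sub>M borel)"
  unfolding W_def by measurable

text \<open>The factor 1/\<open>fX\<close> in W turns \<open>fXY\<close> into f, so the absolute
  first moment is \<open>abs_conv y\<close>, which is finite however small \<open>fX\<close>
  becomes.\<close>

lemma integrable_fXY_W: "integrable lborel (\<lambda>z. fXY z * W y z)"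
proof (rule integrableI_bounded)
  have "norm (fXY z * W y z) = \<bar>K1h (x - fst z)\<bar> * \<bar>K2h (y - snd z)\<bar> * f z" for z
    using fX_pos[of "fst z"] fXY_nonneg[of z] by (simp add: W_def f_eq abs_mult)
  then have "(\<integral>\<^sup>+ z. ennreal (norm (fXY z * W y z)) \<partial>lborel) = abs_conv y"
    by (simp add: abs_conv_def ennreal_mult f_nonneg)
  with abs_conv_finite show "(\<integral>\<^sup>+ z. ennreal (norm (fXY z * W y z)) \<partial>lborel) < \<infinity>" by simp
qed (simp add: W_def)

lemma integral_fXY_W: "(LINT z|lborel. fXY z * W y z) = m y"
  unfolding m_eq by (intro Bochner_Integration.integral_cong) (auto simp: W_def f_eq)

text \<open>Of the two factors 1/\<open>fX\<close> in W^2 one is absorbed into f and the other stays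
  as a weight on the square of \<open>K1h\<close>. This weighted integral may be infinite.\<close>

lemma nn_integral_fXY_W_power2:
  "(\<integral>\<^sup>+ y. \<integral>\<^sup>+ z. ennreal (fXY z) * ennreal ((W y z)\<^sup>2) \<partial>lborel \<partial>lborel) =
    ennreal (1 / (\<Prod>i\<in>UNIV. h $ i)) * ((\<integral>\<^sup>+ v. ennreal ((K2 v)\<^sup>2) \<partial>lborel) *
      (\<integral>\<^sup>+ s. ennreal ((K1 s)\<^sup>2 / fX (x - (\<chi> i. s $ i * h $ Inl i))) \<partial>lborel))"
proof -
  have "(\<integral>\<^sup>+ y. \<integral>\<^sup>+ z. ennreal (fXY z) * ennreal ((W y z)\<^sup>2) \<partial>lborel \<partial>lborel) =
      (\<integral>\<^sup>+ y. \<integral>\<^sup>+ z. ennreal ((K1h (x - fst z))\<^sup>2 / fX (fst z)) * ennreal ((K2h (y - snd z))\<^sup>2) *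
        ennreal (f z) \<partial>lborel \<partial>lborel)"
  proof (intro nn_integral_cong)
    fix y :: "real ^ 'b" and z :: "(real ^ 'a) \<times> (real ^ 'b)"
    have "fXY z * (W y z)\<^sup>2 = ((K1h (x - fst z))\<^sup>2 / fX (fst z)) * (K2h (y - snd z))\<^sup>2 * f z"
      by (simp add: W_def f_eq power_mult_distrib power_divide power2_eq_square)
    then show "ennreal (fXY z) * ennreal ((W y z)\<^sup>2) =
        ennreal ((K1h (x - fst z))\<^sup>2 / fX (fst z)) * ennreal ((K2h (y - snd z))\<^sup>2) * ennreal (f z)"
      using fX_pos[of "fst z"] fXY_nonneg[of z] f_nonneg[of z]
      by (simp add: ennreal_mult[symmetric])
  qed
  also have "\<dots> = (\<integral>\<^sup>+ t. ennreal ((K1h (x - t))\<^sup>2 / fX t) \<partial>lborel) * (\<integral>\<^sup>+ w. ennreal ((K2h w)\<^sup>2) \<partial>lborel)"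
    by (rule nn_integral_conv_f) measurable
  also have "\<dots> = (ennreal (1 / (\<Prod>i\<in>UNIV. h $ Inl i)) * ennreal (1 / (\<Prod>j\<in>UNIV. h $ Inr j))) *
      ((\<integral>\<^sup>+ v. ennreal ((K2 v)\<^sup>2) \<partial>lborel) *
      (\<integral>\<^sup>+ s. ennreal ((K1 s)\<^sup>2 / fX (x - (\<chi> i. s $ i * h $ Inl i))) \<partial>lborel))"
    unfolding nn_integral_K1h_power2 nn_integral_K2h_power2 by (simp only: ac_simps)
  also have "ennreal (1 / (\<Prod>i\<in>UNIV. h $ Inl i)) * ennreal (1 / (\<Prod>j\<in>UNIV. h $ Inr j)) =
      ennreal (1 / (\<Prod>i\<in>UNIV. h $ i))"
    using prod_h_pos by (simp add: prod_UNIV_sum[of "\<lambda>i. h $ i"] ennreal_mult[symmetric])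
  finally show ?thesis .
qed

lemma risk_bias_variance:
  assumes n: "1 \<le> n" and iid: "iid_sample M n X Y fXY"
  shows "(risk M x f (kernel_estimator n fX K X Y h) 2)\<^sup>2 +
      ennreal (1 / real n) * (\<integral>\<^sup>+ y. ennreal ((m y)\<^sup>2) \<partial>lborel) =
    (section_norm x 2 (\<lambda>z. conv (scaled_kernel K h) f z - f z))\<^sup>2 +
      (Lnorm 2 K2)\<^sup>2 / ennreal (real n * (\<Prod>i\<in>UNIV. h $ i)) *
      (\<integral>\<^sup>+ s. ennreal ((K1 s)\<^sup>2 / fX (x - (\<chi> i. s $ i * h $ Inl i))) \<partial>lborel)"
proof -
  interpret prob_space M using iid by (simp add: iid_sample_def)
  have indep: "indep_vars (\<lambda>_. borel) (\<lambda>i \<omega>. (X i \<omega>, Y i \<omega>)) {1..n}"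
    and dist: "\<And>i. i \<in> {1..n} \<Longrightarrow> distributed M lborel (\<lambda>\<omega>. (X i \<omega>, Y i \<omega>)) (\<lambda>z. ennreal (fXY z))"
    using iid by (auto simp: iid_sample_def)
  have [measurable]: "(\<lambda>\<omega>. (X i \<omega>, Y i \<omega>)) \<in> borel_measurable M" if "i \<in> {1..n}" for i
    using distributed_measurable[OF dist[OF that]] by simp
  define Z where "Z y i \<omega> = W y (X i \<omega>, Y i \<omega>)" for y i \<omega>
  define e where "e \<omega> y = 1 / real n * (\<Sum>i=1..n. Z y i \<omega>)" for \<omega> y
  have est: "kernel_estimator n fX K X Y h \<omega> (x, y) = e \<omega> y" for \<omega> y
    by (simp add: kernel_estimator_def e_def Z_def W_def scaled_kernel_eq)
  \<comment> \<open>Joint measurability in the sample point and y is what Tonelli needs to put the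
    integral over y outside.\<close>
  have e_meas[measurable]: "(\<lambda>(\<omega>, y). e \<omega> y) \<in> borel_measurable (M \<Otimes>\<^sub>M borel)"
    unfolding e_def Z_def by measurable
  interpret PS: pair_sigma_finite "lborel :: (real ^ 'b) measure" M ..
  have "(risk M x f (kernel_estimator n fX K X Y h) 2)\<^sup>2 =
      (\<integral>\<^sup>+ y. \<integral>\<^sup>+ \<omega>. ennreal ((e \<omega> y - f (x, y))\<^sup>2) \<partial>M \<partial>lborel)"
    unfolding risk_2_power2 est by (rule PS.Fubini') measurable
  moreover have "ennreal (1 / real n) * (\<integral>\<^sup>+ y. ennreal ((m y)\<^sup>2) \<partial>lborel) =
      (\<integral>\<^sup>+ y. ennreal (1 / real n) * ennreal ((m y)\<^sup>2) \<partial>lborel)"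
    by (rule nn_integral_cmult[symmetric]) measurable
  ultimately have "(risk M x f (kernel_estimator n fX K X Y h) 2)\<^sup>2 +
      ennreal (1 / real n) * (\<integral>\<^sup>+ y. ennreal ((m y)\<^sup>2) \<partial>lborel) =
      (\<integral>\<^sup>+ y. (\<integral>\<^sup>+ \<omega>. ennreal ((e \<omega> y - f (x, y))\<^sup>2) \<partial>M) + ennreal (1 / real n) * ennreal ((m y)\<^sup>2) \<partial>lborel)"
    by (subst nn_integral_add) auto
  also have "\<dots> = (\<integral>\<^sup>+ y. ennreal ((m y - f (x, y))\<^sup>2) +
      ennreal (1 / real n) * (\<integral>\<^sup>+ z. ennreal (fXY z) * ennreal ((W y z)\<^sup>2) \<partial>lborel) \<partial>lborel)"
  proof (rule nn_integral_cong)
    fix y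
    have ind: "indep_vars (\<lambda>_. borel) (Z y) {1..n}"
      unfolding Z_def by (rule indep_vars_compose2[OF indep]) measurable
    have int: "integrable M (Z y i)" if "i \<in> {1..n}" for i
      unfolding Z_def using integrable_fXY_W[of y] fXY_nonneg
      by (subst distributed_integrable[OF dist[OF that], symmetric]) auto
    have mean: "expectation (Z y i) = m y" if "i \<in> {1..n}" for i
      unfolding Z_def integral_fXY_W[symmetric] using fXY_nonneg
      by (subst distributed_integral[OF dist[OF that], symmetric]) auto
    have mom: "(\<integral>\<^sup>+ \<omega>. ennreal ((Z y i \<omega>)\<^sup>2) \<partial>M) = (\<integral>\<^sup>+ z. ennreal (fXY z) * ennreal ((W y z)\<^sup>2) \<partial>lborel)"
      if "i \<in> {1..n}" for i
      unfolding Z_def by (subst distributed_nn_integral[OF dist[OF that]]) auto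
    show "(\<integral>\<^sup>+ \<omega>. ennreal ((e \<omega> y - f (x, y))\<^sup>2) \<partial>M) + ennreal (1 / real n) * ennreal ((m y)\<^sup>2) =
      ennreal ((m y - f (x, y))\<^sup>2) +
      ennreal (1 / real n) * (\<integral>\<^sup>+ z. ennreal (fXY z) * ennreal ((W y z)\<^sup>2) \<partial>lborel)"
      unfolding e_def by (rule nn_integral_power2_mean_diff[OF n ind int mean mom])
  qed
  also have "\<dots> = (\<integral>\<^sup>+ y. ennreal ((m y - f (x, y))\<^sup>2) \<partial>lborel) +
      ennreal (1 / real n) * (\<integral>\<^sup>+ y. \<integral>\<^sup>+ z. ennreal (fXY z) * ennreal ((W y z)\<^sup>2) \<partial>lborel \<partial>lborel)"
    by (simp add: nn_integral_add nn_integral_cmult)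
  also have "ennreal (1 / real n) * (\<integral>\<^sup>+ y. \<integral>\<^sup>+ z. ennreal (fXY z) * ennreal ((W y z)\<^sup>2) \<partial>lborel \<partial>lborel) =
      (Lnorm 2 K2)\<^sup>2 / ennreal (real n * (\<Prod>i\<in>UNIV. h $ i)) *
      (\<integral>\<^sup>+ s. ennreal ((K1 s)\<^sup>2 / fX (x - (\<chi> i. s $ i * h $ Inl i))) \<partial>lborel)"
  proof -
    have "0 < (\<Prod>i\<in>UNIV. h $ i)" by (auto intro: prod_pos h_pos)
    then have "ennreal (1 / real n) * ennreal (1 / (\<Prod>i\<in>UNIV. h $ i)) =
        inverse (ennreal (real n * (\<Prod>i\<in>UNIV. h $ i)))"
      using n by (simp add: ennreal_mult[symmetric] inverse_ennreal inverse_eq_divide)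
    then show ?thesis
      unfolding nn_integral_fXY_W_power2 Lnorm_2_power2 divide_ennreal_def
      by (simp add: mult.assoc[symmetric]) (simp add: mult.commute)
  qed
  finally show ?thesis
    by (simp add: section_norm_def Lnorm_2_power2)
qed

text \<open>The bound on int m^2 removes it from the bias-variance identity. The conclusion is in
  the extended reals because its last term is nonpositive and the right side can be
  negative.\<close>

lemma risk_lower_bound:
  assumes n: "1 \<le> n" and iid: "iid_sample M n X Y fXY"
  shows "enn2ereal ((risk M x f (kernel_estimator n fX K X Y h) 2)\<^sup>2) \<ge>
    enn2ereal ((section_norm x 2 (\<lambda>z. conv (scaled_kernel K h) f z - f z))\<^sup>2
      + (Lnorm 2 K2)\<^sup>2 / ennreal (real n * (\<Prod>i\<in>UNIV. h $ i)) *
      (\<integral>\<^sup>+ s. ennreal ((K1 s)\<^sup>2 / fX (x - (\<chi> i. s $ i * h $ Inl i))) \<partial>lborel))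
    + ereal (- (F * (enn2real norm1)\<^sup>2) / real n)"
    (is "enn2ereal ?R \<ge> enn2ereal ?B + _")
proof -
  have N: "norm1 = ennreal (enn2real norm1)" using L1_finite by simp
  have "?B \<le> ?R + ennreal (1 / real n) * (ennreal F * norm1\<^sup>2)"
    unfolding risk_bias_variance[OF assms, symmetric]
    by (intro add_left_mono mult_left_mono nn_integral_m_power2_le) auto
  also have "ennreal (1 / real n) * (ennreal F * norm1\<^sup>2) = ennreal (F * (enn2real norm1)\<^sup>2 / real n)"
    by (subst N) (simp add: F_nonneg ennreal_power ennreal_mult[symmetric])
  finally have "enn2ereal ?B \<le> enn2ereal ?R + ereal (F * (enn2real norm1)\<^sup>2 / real n)"
    using F_nonneg by (simp add: less_eq_ennreal.rep_eq plus_ennreal.rep_eq)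
  \<comment> \<open>The term moved across is a real number, so the step is valid even when both
    remaining quantities are infinite.\<close>
  then have "enn2ereal ?B - ereal (F * (enn2real norm1)\<^sup>2 / real n) \<le> enn2ereal ?R"
    by (subst ereal_minus_le_iff) (auto simp: add.commute)
  then show ?thesis by (simp add: minus_ereal_def)
qed

end

section \<open>Measurability and norms of the kernel factors\<close>

text \<open>Through a point where K does not vanish, each factor is a section of K divided by a
  nonzero constant.\<close>

lemma product_factors_measurable:
  fixes K :: "'a::euclidean_space \<times> 'b::euclidean_space \<Rightarrow> real"
  assumes K: "K \<in> borel_measurable borel" and prod: "\<And>u v. K (u, v) = K1 u * K2 v" and nz: "K (u0, v0) \<noteq> 0"
  shows "K1 \<in> borel_measurable borel" "K2 \<in> borel_measurable borel"
proof -
  have [measurable]: "K \<in> borel_measurable (borel \<Otimes>\<^sub>M borel)"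
    using K by (simp add: borel_prod)
  have "K1 u0 \<noteq> 0" "K2 v0 \<noteq> 0" using nz by (auto simp: prod)
  then have "K1 = (\<lambda>u. K (u, v0) / K2 v0)" "K2 = (\<lambda>v. K (u0, v) / K1 u0)"
    by (auto simp: prod)
  moreover have "(\<lambda>u. K (u, v0) / K2 v0) \<in> borel_measurable borel"
    "(\<lambda>v. K (u0, v) / K1 u0) \<in> borel_measurable borel"
    by measurable
  ultimately show "K1 \<in> borel_measurable borel" "K2 \<in> borel_measurable borel" by simp_all
qed

lemma Lnorm_1_product:
  fixes K :: "'a::euclidean_space \<times> 'b::euclidean_space \<Rightarrow> real"
  assumes [measurable]: "K1 \<in> borel_measurable borel" "K2 \<in> borel_measurable borel"
    and prod: "\<And>u v. K (u, v) = K1 u * K2 v"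
  shows "Lnorm 1 K = (\<integral>\<^sup>+ u. ennreal \<bar>K1 u\<bar> \<partial>lborel) * (\<integral>\<^sup>+ v. ennreal \<bar>K2 v\<bar> \<partial>lborel)"
proof -
  have "ennreal \<bar>K z\<bar> = ennreal \<bar>K1 (fst z)\<bar> * ennreal \<bar>K2 (snd z)\<bar>" for z
    using prod[of "fst z" "snd z"] by (simp add: abs_mult ennreal_mult)
  then show ?thesis
    using nn_integral_lborel_pair_mult[of "\<lambda>u. ennreal \<bar>K1 u\<bar>" "\<lambda>v. ennreal \<bar>K2 v\<bar>"]
    by (simp add: Lnorm_1)
qed

lemma Lnorm_2_product:
  fixes K :: "'a::euclidean_space \<times> 'b::euclidean_space \<Rightarrow> real"
  assumes [measurable]: "K1 \<in> borel_measurable borel" "K2 \<in> borel_measurable borel"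
    and prod: "\<And>u v. K (u, v) = K1 u * K2 v"
  shows "(Lnorm 2 K)\<^sup>2 = (Lnorm 2 K1)\<^sup>2 * (Lnorm 2 K2)\<^sup>2"
proof -
  have "ennreal ((K z)\<^sup>2) = ennreal ((K1 (fst z))\<^sup>2) * ennreal ((K2 (snd z))\<^sup>2)" for z
    using prod[of "fst z" "snd z"] by (simp add: power_mult_distrib ennreal_mult)
  then show ?thesis
    using nn_integral_lborel_pair_mult[of "\<lambda>u. ennreal ((K1 u)\<^sup>2)" "\<lambda>v. ennreal ((K2 v)\<^sup>2)"]
    by (simp add: Lnorm_2_power2)
qed

text \<open>A constant lower bound c for 1/\<phi> on the support of K1 comes out of the integral,
  and the two factor norms recombine into that of K. Finiteness of \<open>Lnorm 2 K\<close> ensures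
  that \<open>enn2real\<close> keeps its value.\<close>

lemma variance_term_ge:
  fixes K :: "'a::euclidean_space \<times> 'b::euclidean_space \<Rightarrow> real"
  assumes meas: "K1 \<in> borel_measurable borel" "K2 \<in> borel_measurable borel"
    and prod: "\<And>u v. K (u, v) = K1 u * K2 v"
    and fin: "Lnorm 2 K < \<infinity>" and c: "0 \<le> c" "\<And>s. K1 s \<noteq> 0 \<Longrightarrow> c \<le> 1 / \<phi> s" and q: "0 < q"
  shows "ennreal ((enn2real (Lnorm 2 K))\<^sup>2 / q * c) \<le>
    (Lnorm 2 K2)\<^sup>2 / ennreal q * (\<integral>\<^sup>+ s. ennreal ((K1 s)\<^sup>2 / \<phi> s) \<partial>lborel)"
proof -
  note [measurable] = meas
  have "ennreal c * (Lnorm 2 K1)\<^sup>2 = (\<integral>\<^sup>+ s. ennreal c * ennreal ((K1 s)\<^sup>2) \<partial>lborel)"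
    by (simp add: Lnorm_2_power2 nn_integral_cmult)
  also have "\<dots> \<le> (\<integral>\<^sup>+ s. ennreal ((K1 s)\<^sup>2 / \<phi> s) \<partial>lborel)"
  proof (rule nn_integral_mono)
    fix s
    show "ennreal c * ennreal ((K1 s)\<^sup>2) \<le> ennreal ((K1 s)\<^sup>2 / \<phi> s)"
      using c(1) mult_left_mono[OF c(2), of s "(K1 s)\<^sup>2"]
      by (cases "K1 s = 0") (auto simp: ennreal_mult[symmetric] mult.commute intro!: ennreal_leI)
  qed
  finally have I: "ennreal c * (Lnorm 2 K1)\<^sup>2 \<le> (\<integral>\<^sup>+ s. ennreal ((K1 s)\<^sup>2 / \<phi> s) \<partial>lborel)" .
  have "ennreal ((enn2real (Lnorm 2 K))\<^sup>2) = (Lnorm 2 K1)\<^sup>2 * (Lnorm 2 K2)\<^sup>2"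
    using fin by (simp add: Lnorm_2_product[OF meas prod, symmetric] ennreal_power[symmetric])
  then have "ennreal ((enn2real (Lnorm 2 K))\<^sup>2 / q * c) = (Lnorm 2 K2)\<^sup>2 / ennreal q * (ennreal c * (Lnorm 2 K1)\<^sup>2)"
    using q c(1) by (simp add: ennreal_mult divide_ennreal[symmetric] divide_ennreal_def ac_simps)
  also have "\<dots> \<le> (Lnorm 2 K2)\<^sup>2 / ennreal q * (\<integral>\<^sup>+ s. ennreal ((K1 s)\<^sup>2 / \<phi> s) \<partial>lborel)"
    using I by (rule mult_left_mono) simp
  finally show ?thesis .
qed

section \<open>Boxes around x and densities of the sample\<close>

lemma sup_on_le_imp_le:
  assumes "sup_on V f \<le> ennreal F" "0 \<le> F" "t \<in> V"
  shows "f (t, y) \<le> F"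
proof -
  have "ennreal (f (t, y)) \<le> (SUP y. ennreal (f (t, y)))"
    by (rule SUP_upper) simp
  also have "\<dots> \<le> sup_on V f"
    unfolding sup_on_def using assms(3) by (rule SUP_upper)
  also note assms(1)
  finally show ?thesis using assms(2) by (simp add: ennreal_le_iff)
qed

lemma sup_on_mono: "V \<subseteq> W \<Longrightarrow> sup_on V f \<le> sup_on W f"
  unfolding sup_on_def by (rule SUP_subset_mono) auto

lemma nbhd_box_antimono:
  assumes "0 < A" "0 < k" "k \<le> k'"
  shows "nbhd_box A x k' \<subseteq> nbhd_box A x k"
proof -
  have "2 * A / k' \<le> 2 * A / k" using assms by (intro divide_left_mono) auto
  then have "x $ i - 2 * A / k \<le> x $ i - 2 * A / k'" "x $ i + 2 * A / k' \<le> x $ i + 2 * A / k" for i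
    by auto
  then show ?thesis unfolding nbhd_box_def by (blast intro: order_trans)
qed

text \<open>Each coordinate of x - t is at most A \<open>b i\<close> <= A/k in absolute value, which
  is within the half-width 2A/k of the box.\<close>

lemma kernel_support_subset_nbhd_box:
  fixes x t :: "real ^ 'a::finite"
  assumes "0 < A" "0 < k" "\<And>i. 0 < b i" "\<And>i. b i \<le> 1 / k" "\<And>i. \<bar>(x - t) $ i / b i\<bar> \<le> A"
  shows "t \<in> nbhd_box A x k"
proof -
  have "\<bar>x $ i - t $ i\<bar> \<le> 2 * A / k" for i
  proof -
    have "\<bar>x $ i - t $ i\<bar> \<le> A * b i"
      using assms(5)[of i] assms(3)[of i] by (simp add: abs_divide field_simps)
    also have "\<dots> \<le> A * (1 / k)" using assms by (intro mult_left_mono) auto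
    also have "\<dots> \<le> 2 * A / k" using assms by (simp add: field_simps)
    finally show ?thesis .
  qed
  then show ?thesis unfolding nbhd_box_def by (auto simp: abs_le_iff algebra_simps)
qed

text \<open>Everything is read off from the first observation, which exists because n >= 1.\<close>

lemma sample_imp_densities_measurable:
  fixes fXY :: "'a::euclidean_space \<times> 'b::euclidean_space \<Rightarrow> real"
  assumes "1 \<le> n" "iid_sample M n X Y fXY" "\<And>z. 0 \<le> fXY z"
    "\<forall>i\<in>{1..n}. distributed M lborel (X i) (\<lambda>t. ennreal (fX t))" "\<And>t. 0 < fX t"
  shows "fXY \<in> borel_measurable borel" "fX \<in> borel_measurable borel"
    "AE t in lborel. ennreal (fX t) = (\<integral>\<^sup>+ v. ennreal (fXY (t, v)) \<partial>lborel)"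
proof -
  interpret prob_space M using assms(2) by (simp add: iid_sample_def)
  have XY: "distributed M lborel (\<lambda>\<omega>. (X 1 \<omega>, Y 1 \<omega>)) (\<lambda>z. ennreal (fXY z))"
    using assms(1,2) by (auto simp: iid_sample_def)
  have X: "distributed M lborel (X 1) (\<lambda>t. ennreal (fX t))"
    using assms(1,4) by auto
  show "fXY \<in> borel_measurable borel"
    using distributed_real_measurable[OF _ XY] assms(3) by simp
  show "fX \<in> borel_measurable borel"
    using distributed_real_measurable[OF _ X] assms(5) by (simp add: less_imp_le)
  show "AE t in lborel. ennreal (fX t) = (\<integral>\<^sup>+ v. ennreal (fXY (t, v)) \<partial>lborel)"
    using XY by (intro distributed_marginal_eq_joint1[OF _ _ X])
      (auto simp: lborel_prod lborel.sigma_finite_measure_axioms)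
qed

section \<open>Uniform comparison of the density near x with its value at x\<close>

text \<open>The infimum includes \<open>0\<close> so that it is meaningful for empty \<open>H\<close>.\<close>

definition density_ratio_defect ::
  "real \<Rightarrow> (real ^ 'a::finite \<Rightarrow> real) \<Rightarrow> real ^ 'a \<Rightarrow> (real ^ ('a + 'b::finite)) set \<Rightarrow> real"
where
  "density_ratio_defect A fX x H = Inf (insert 0
     {fX x / fX (x - (\<chi> i. s $ i * h $ Inl i)) - 1 |h s. h \<in> H \<and> (\<forall>i. \<bar>s $ i\<bar> \<le> A)})"

text \<open>Positivity of \<open>fX\<close> bounds all the ratios minus 1 below by -1. Hence the
  infimum is a genuine lower bound, and 1 plus the defect is nonnegative, as the comparison of
  variance terms requires.\<close>

lemma density_ratio_defect_bounds:
  assumes pos: "\<And>t. 0 < fX t"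
  shows "-1 \<le> density_ratio_defect A fX x H" "density_ratio_defect A fX x H \<le> 0"
    "h \<in> H \<Longrightarrow> (\<And>i. \<bar>s $ i\<bar> \<le> A) \<Longrightarrow>
      (1 + density_ratio_defect A fX x H) / fX x \<le> 1 / fX (x - (\<chi> i. s $ i * h $ Inl i))"
proof -
  let ?S = "insert 0 {fX x / fX (x - (\<chi> i. s $ i * h $ Inl i)) - 1 |h s. h \<in> H \<and> (\<forall>i. \<bar>s $ i\<bar> \<le> A)}"
  have lb: "-1 \<le> z" if "z \<in> ?S" for z
    using that pos by (auto simp: less_imp_le)
  then have bdd: "bdd_below ?S" by (intro bdd_belowI[of _ "-1"]) auto
  show "-1 \<le> density_ratio_defect A fX x H"
    unfolding density_ratio_defect_def using lb by (intro cInf_greatest) auto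
  show "density_ratio_defect A fX x H \<le> 0"
    unfolding density_ratio_defect_def using bdd by (intro cInf_lower) auto
  assume "h \<in> H" "\<And>i. \<bar>s $ i\<bar> \<le> A"
  then have "density_ratio_defect A fX x H \<le> fX x / fX (x - (\<chi> i. s $ i * h $ Inl i)) - 1"
    unfolding density_ratio_defect_def using bdd by (intro cInf_lower) auto
  then have "(1 + density_ratio_defect A fX x H) / fX x \<le> (fX x / fX (x - (\<chi> i. s $ i * h $ Inl i))) / fX x"
    using pos[of x] by (intro divide_right_mono) auto
  then show "(1 + density_ratio_defect A fX x H) / fX x \<le> 1 / fX (x - (\<chi> i. s $ i * h $ Inl i))"
    using pos[of x] by simp
qed

text \<open>The displacement s h has norm at most d1 A / \<open>k n\<close>, where d1 is
  \<open>CARD('a)\<close>, uniformly in h and s. Continuity of the ratio at x then bounds the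
  infimum below, while the inserted 0 bounds it above.\<close>

lemma density_ratio_defect_tendsto_0:
  fixes x :: "real ^ 'a::finite" and H :: "nat \<Rightarrow> (real ^ ('a + 'b::finite)) set"
  assumes pos: "\<And>t. 0 < fX t" and cont: "isCont fX x" and A: "0 < A"
    and k: "\<forall>n\<ge>1. 1 < k n" "filterlim k at_top sequentially"
    and H: "\<forall>n\<ge>1. \<forall>h\<in>H n. (\<forall>i. 0 < h $ i) \<and> (\<forall>i. h $ Inl i \<le> 1 / k n)"
  shows "(\<lambda>n. density_ratio_defect A fX x (H n)) \<longlonglongrightarrow> 0"
proof (rule LIMSEQ_I)
  fix r :: real assume "0 < r"
  \<comment> \<open>The infimum inherits only a weak inequality from its elements, so half of r is
    used to reach the strict one.\<close>
  define e where "e = r / 2"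
  have e: "0 < e" "e < r" using \<open>0 < r\<close> by (auto simp: e_def)
  have "isCont (\<lambda>t. fX x / fX t - 1) x"
    using pos[of x] by (intro continuous_intros cont) auto
  then obtain d where d: "0 < d" "\<And>t. dist t x < d \<Longrightarrow> dist (fX x / fX t - 1) (fX x / fX x - 1) < e"
    using e(1) unfolding continuous_at_eps_delta by blast
  \<comment> \<open>The threshold makes the l1 norm of the displacement, a sum of
    \<open>CARD('a)\<close> terms of size at most A / \<open>k n\<close>, smaller than d.\<close>
  have "eventually (\<lambda>n. real CARD('a) * A / d < k n \<and> 1 \<le> n) sequentially"
    using k(2) by (intro eventually_conj eventually_ge_at_top) (auto simp: filterlim_at_top_dense)
  then obtain n0 where n0: "\<And>n. n \<ge> n0 \<Longrightarrow> real CARD('a) * A / d < k n \<and> 1 \<le> n"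
    by (auto simp: eventually_sequentially)
  have "norm (density_ratio_defect A fX x (H n) - 0) < r" if "n \<ge> n0" for n
  proof -
    have n: "real CARD('a) * A / d < k n" "1 \<le> n" "0 < k n"
      using n0[OF that] k(1) by (auto intro: less_trans[of 0 1])
    have "- e \<le> density_ratio_defect A fX x (H n)"
      unfolding density_ratio_defect_def
    proof (rule cInf_greatest)
      fix z assume "z \<in> insert 0 {fX x / fX (x - (\<chi> i. s $ i * h $ Inl i)) - 1 |h s.
        h \<in> H n \<and> (\<forall>i. \<bar>s $ i\<bar> \<le> A)}"
      then show "- e \<le> z"
      proof (elim insertE CollectE exE conjE)
        assume "z = 0" then show ?thesis using e by simp
      next
        fix h :: "real ^ ('a + 'b)" and s :: "real ^ 'a"
        assume z: "z = fX x / fX (x - (\<chi> i. s $ i * h $ Inl i)) - 1"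
          and h: "h \<in> H n" and s: "\<forall>i. \<bar>s $ i\<bar> \<le> A"
        have "norm (\<chi> i. s $ i * h $ Inl i) \<le> (\<Sum>i\<in>UNIV. \<bar>s $ i * h $ Inl i\<bar>)"
          using norm_le_l1_cart[of "\<chi> i. s $ i * h $ Inl i"] by simp
        also have "\<dots> \<le> (\<Sum>i\<in>(UNIV :: 'a set). A * (1 / k n))"
        proof (rule sum_mono)
          fix i
          have "0 < h $ Inl i" "h $ Inl i \<le> 1 / k n" using H h n(2) by blast+
          then show "\<bar>s $ i * h $ Inl i\<bar> \<le> A * (1 / k n)"
            using s A by (subst abs_mult) (intro mult_mono, auto)
        qed
        also have "\<dots> < d"
          using n d(1) by (simp add: field_simps)
        finally have "dist (x - (\<chi> i. s $ i * h $ Inl i)) x < d"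
          by (simp add: dist_norm)
        from d(2)[OF this] show ?thesis
          using pos[of x] by (simp add: z dist_real_def)
      qed
    qed simp
    moreover have "density_ratio_defect A fX x (H n) \<le> 0"
      by (rule density_ratio_defect_bounds(2)[OF pos])
    ultimately show ?thesis using e by simp
  qed
  then show "\<exists>n0. \<forall>n\<ge>n0. norm (density_ratio_defect A fX x (H n) - 0) < r" by blast
qed

section \<open>Both lower bounds under the stated hypotheses\<close>

text \<open>The support condition becomes the pointwise bound of \<open>product_kernel\<close>: if
  K1 does not vanish at the rescaled x - t, then t lies in the box, where f is at most F.\<close>

lemma kernel_estimator_risk_lower_bound:
  fixes X :: "nat \<Rightarrow> 'w \<Rightarrow> real ^ 'a::finite" and Y :: "nat \<Rightarrow> 'w \<Rightarrow> real ^ 'b::finite"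
    and fXY :: "(real ^ 'a) \<times> (real ^ 'b) \<Rightarrow> real"
  assumes n: "1 \<le> n" and fXY: "\<And>z. 0 \<le> fXY z" and iid: "iid_sample M n X Y fXY"
    and X: "\<forall>i\<in>{1..n}. distributed M lborel (X i) (\<lambda>t. ennreal (fX t))" and fX: "\<And>t. 0 < fX t"
    and A: "0 < A" and k: "0 < k" and h: "\<And>i. 0 < h $ i" "\<And>i. h $ Inl i \<le> 1 / k"
    and K12: "K1 \<in> borel_measurable borel" "K2 \<in> borel_measurable borel"
    and prod: "\<And>u v. K (u, v) = K1 u * K2 v" and K: "Lnorm 1 K < \<infinity>"
    and supp: "\<And>u i. K1 u \<noteq> 0 \<Longrightarrow> \<bar>u $ i\<bar> \<le> A"
    and F: "0 \<le> F" "sup_on (nbhd_box A x k) (cond_density fXY fX) \<le> ennreal F"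
  shows "enn2ereal ((risk M x (cond_density fXY fX) (kernel_estimator n fX K X Y h) 2)\<^sup>2) \<ge>
    enn2ereal ((section_norm x 2 (\<lambda>z. conv (scaled_kernel K h) (cond_density fXY fX) z - cond_density fXY fX z))\<^sup>2
      + (Lnorm 2 K2)\<^sup>2 / ennreal (real n * (\<Prod>i\<in>UNIV. h $ i)) *
      (\<integral>\<^sup>+ s. ennreal ((K1 s)\<^sup>2 / fX (x - (\<chi> i. s $ i * h $ Inl i))) \<partial>lborel))
    + ereal (- (F * (enn2real (Lnorm 1 K))\<^sup>2) / real n)"
proof -
  note L1 = Lnorm_1_product[where K = K, OF K12 prod]
  have K_eq: "K = (\<lambda>(u, v). K1 u * K2 v)" using prod by auto
  interpret product_kernel K1 K2 h fXY fX x F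
  proof
    fix t v assume nz: "K1 (\<chi> i. (x - t) $ i / h $ Inl i) \<noteq> 0"
    have "t \<in> nbhd_box A x k"
      using h supp[OF nz] by (intro kernel_support_subset_nbhd_box[OF A k, of "\<lambda>i. h $ Inl i"]) auto
    then show "cond_density fXY fX (t, v) \<le> F"
      by (rule sup_on_le_imp_le[OF F(2,1)])
  qed (fact K12 h(1) fXY fX F(1) K[unfolded L1] sample_imp_densities_measurable[OF n iid fXY X fX])+
  show ?thesis
    using risk_lower_bound[OF n iid] unfolding K_eq[symmetric] L1[symmetric] .
qed

theorem proposition1:
  shows "\<exists>C1 :: real \<Rightarrow> real \<Rightarrow> real.
    \<forall>(M :: nat \<Rightarrow> 'w measure)
      (X :: nat \<Rightarrow> nat \<Rightarrow> 'w \<Rightarrow> real ^ 'a::finite) (Y :: nat \<Rightarrow> nat \<Rightarrow> 'w \<Rightarrow> real ^ 'b::finite)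
      (fXY :: (real ^ 'a) \<times> (real ^ 'b) \<Rightarrow> real) (fX :: real ^ 'a \<Rightarrow> real)
      (f :: (real ^ 'a) \<times> (real ^ 'b) \<Rightarrow> real) (x :: real ^ 'a)
      (A :: real) (k :: nat \<Rightarrow> real) (H :: nat \<Rightarrow> (real ^ ('a + 'b)) set)
      (K :: (real ^ 'a) \<times> (real ^ 'b) \<Rightarrow> real) (K1 :: real ^ 'a \<Rightarrow> real) (K2 :: real ^ 'b \<Rightarrow> real).
    (\<forall>z. 0 \<le> fXY z) \<longrightarrow>
    (\<forall>n\<ge>1. iid_sample (M n) n (X n) (Y n) fXY) \<longrightarrow>
    (\<forall>n\<ge>1. \<forall>i\<in>{1..n}. distributed (M n) lborel (X n i) (\<lambda>t. ennreal (fX t))) \<longrightarrow>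
    (\<forall>t. 0 < fX t) \<longrightarrow>
    f = cond_density fXY fX \<longrightarrow>
    0 < A \<longrightarrow>
    (\<forall>n\<ge>1. 1 < k n) \<longrightarrow> filterlim k at_top sequentially \<longrightarrow>
    (\<forall>n\<ge>1. \<forall>h\<in>H n. (\<forall>i. 0 < h $ i) \<and> (\<forall>i. h $ Inl i \<le> 1 / k n)) \<longrightarrow>
    bounded (range K) \<longrightarrow> integrable lborel K \<longrightarrow> (LINT z|lborel. K z) = 1 \<longrightarrow> Lnorm 2 K < \<infinity> \<longrightarrow>
    (\<forall>n\<ge>1. sup_on (nbhd_box A x (k n)) f < \<infinity>) \<longrightarrow>
    (\<forall>u v. K (u, v) = K1 u * K2 v) \<longrightarrow>
    (\<forall>u. K1 u \<noteq> 0 \<longrightarrow> (\<forall>i. \<bar>u $ i\<bar> \<le> A)) \<longrightarrow>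
    (\<forall>n\<ge>1. \<forall>F\<ge>0. sup_on (nbhd_box A x (k n)) f \<le> ennreal F \<longrightarrow> (\<forall>h\<in>H n.
       enn2ereal ((risk (M n) x f (kernel_estimator n fX K (X n) (Y n) h) 2)\<^sup>2) \<ge>
         enn2ereal ((section_norm x 2 (\<lambda>z. conv (scaled_kernel K h) f z - f z))\<^sup>2
           + (Lnorm 2 K2)\<^sup>2 / ennreal (real n * (\<Prod>i\<in>UNIV. h $ i))
             * (\<integral>\<^sup>+ s. ennreal ((K1 s)\<^sup>2 / fX (x - (\<chi> i. s $ i * h $ Inl i))) \<partial>lborel))
         + ereal (C1 (enn2real (Lnorm 1 K)) F / real n))) \<and>
    ((\<exists>U. open U \<and> x \<in> U \<and> (\<forall>t\<in>U. 0 < fX t) \<and> continuous_on U fX) \<longrightarrow>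
     (\<lambda>n. max_bandwidth (H n)) \<longlonglongrightarrow> 0 \<longrightarrow>
     (\<exists>(\<epsilon> :: nat \<Rightarrow> real) (r :: nat \<Rightarrow> real). \<epsilon> \<in> o(\<lambda>_. 1) \<and> r \<in> O(\<lambda>n. 1 / real n) \<and>
       (\<forall>\<^sub>F n in sequentially. \<forall>h\<in>H n.
         enn2ereal ((risk (M n) x f (kernel_estimator n fX K (X n) (Y n) h) 2)\<^sup>2) \<ge>
           enn2ereal ((section_norm x 2 (\<lambda>z. conv (scaled_kernel K h) f z - f z))\<^sup>2)
           + ereal ((enn2real (Lnorm 2 K))\<^sup>2 / (fX x * real n * (\<Prod>i\<in>UNIV. h $ i)) * (1 + \<epsilon> n))
           + ereal (r n))))"
proof (rule exI[of _ "\<lambda>a F. - (F * a\<^sup>2)"], intro allI impI)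
  fix M :: "nat \<Rightarrow> 'w measure"
    and X :: "nat \<Rightarrow> nat \<Rightarrow> 'w \<Rightarrow> real ^ 'a" and Y :: "nat \<Rightarrow> nat \<Rightarrow> 'w \<Rightarrow> real ^ 'b"
    and fXY f :: "(real ^ 'a) \<times> (real ^ 'b) \<Rightarrow> real" and fX :: "real ^ 'a \<Rightarrow> real" and x :: "real ^ 'a"
    and A :: real and k :: "nat \<Rightarrow> real" and H :: "nat \<Rightarrow> (real ^ ('a + 'b)) set"
    and K :: "(real ^ 'a) \<times> (real ^ 'b) \<Rightarrow> real" and K1 :: "real ^ 'a \<Rightarrow> real" and K2 :: "real ^ 'b \<Rightarrow> real"
  assume fXY: "\<forall>z. 0 \<le> fXY z"
    and iid: "\<forall>n\<ge>1. iid_sample (M n) n (X n) (Y n) fXY"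
    and X: "\<forall>n\<ge>1. \<forall>i\<in>{1..n}. distributed (M n) lborel (X n i) (\<lambda>t. ennreal (fX t))"
    and fX: "\<forall>t. 0 < fX t" and f: "f = cond_density fXY fX" and A: "0 < A"
    and k: "\<forall>n\<ge>1. 1 < k n" "filterlim k at_top sequentially"
    and H: "\<forall>n\<ge>1. \<forall>h\<in>H n. (\<forall>i. 0 < h $ i) \<and> (\<forall>i. h $ Inl i \<le> 1 / k n)"
    and K: "integrable lborel K" "(LINT z|lborel. K z) = 1" "Lnorm 2 K < \<infinity>"
    and sup: "\<forall>n\<ge>1. sup_on (nbhd_box A x (k n)) f < \<infinity>"
    and prod: "\<forall>u v. K (u, v) = K1 u * K2 v"
    and supp: "\<forall>u. K1 u \<noteq> 0 \<longrightarrow> (\<forall>i. \<bar>u $ i\<bar> \<le> A)"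
  \<comment> \<open>If one factor vanished identically, the other could be non-measurable. The total
    integral 1 excludes this.\<close>
  have "\<exists>u0 v0. K (u0, v0) \<noteq> 0"
  proof (rule ccontr)
    assume "\<not> (\<exists>u0 v0. K (u0, v0) \<noteq> 0)"
    then have "K = (\<lambda>_. 0)" by auto
    with K(2) show False by simp
  qed
  then have K12: "K1 \<in> borel_measurable borel" "K2 \<in> borel_measurable borel"
    using product_factors_measurable[of K K1 K2] K(1) prod by auto
  have L1: "Lnorm 1 K < \<infinity>"
    using K(1) by (simp add: Lnorm_1 integrable_iff_bounded)
  have bound: "enn2ereal ((risk (M n) x f (kernel_estimator n fX K (X n) (Y n) h) 2)\<^sup>2) \<ge>
      enn2ereal ((section_norm x 2 (\<lambda>z. conv (scaled_kernel K h) f z - f z))\<^sup>2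
        + (Lnorm 2 K2)\<^sup>2 / ennreal (real n * (\<Prod>i\<in>UNIV. h $ i))
          * (\<integral>\<^sup>+ s. ennreal ((K1 s)\<^sup>2 / fX (x - (\<chi> i. s $ i * h $ Inl i))) \<partial>lborel))
      + ereal (- (F * (enn2real (Lnorm 1 K))\<^sup>2) / real n)"
    if "1 \<le> n" "0 \<le> F" "sup_on (nbhd_box A x (k n)) f \<le> ennreal F" "h \<in> H n" for n F h
    unfolding f
  proof (rule kernel_estimator_risk_lower_bound[where A = A and k = "k n"])
    show "0 < k n" using k(1) that(1) by (auto intro: less_trans[of 0 1])
    show "0 < h $ i" for i using H that(1,4) by blast
    show "h $ Inl i \<le> 1 / k n" for i using H that(1,4) by blast
    show "\<bar>u $ i\<bar> \<le> A" if "K1 u \<noteq> 0" for u i using supp that by blast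
    show "sup_on (nbhd_box A x (k n)) (cond_density fXY fX) \<le> ennreal F" using that(3) f by simp
  qed (fact that(1,2) fXY[rule_format] iid[rule_format, OF that(1)] X[THEN spec, THEN mp, OF that(1)]
      fX[rule_format] A K12 prod[rule_format] L1)+
  show "(\<forall>n\<ge>1. \<forall>F\<ge>0. sup_on (nbhd_box A x (k n)) f \<le> ennreal F \<longrightarrow> (\<forall>h\<in>H n.
       enn2ereal ((risk (M n) x f (kernel_estimator n fX K (X n) (Y n) h) 2)\<^sup>2) \<ge>
         enn2ereal ((section_norm x 2 (\<lambda>z. conv (scaled_kernel K h) f z - f z))\<^sup>2
           + (Lnorm 2 K2)\<^sup>2 / ennreal (real n * (\<Prod>i\<in>UNIV. h $ i))
             * (\<integral>\<^sup>+ s. ennreal ((K1 s)\<^sup>2 / fX (x - (\<chi> i. s $ i * h $ Inl i))) \<partial>lborel))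
         + ereal (- (F * (enn2real (Lnorm 1 K))\<^sup>2) / real n))) \<and>
    ((\<exists>U. open U \<and> x \<in> U \<and> (\<forall>t\<in>U. 0 < fX t) \<and> continuous_on U fX) \<longrightarrow>
     (\<lambda>n. max_bandwidth (H n)) \<longlonglongrightarrow> 0 \<longrightarrow>
     (\<exists>(\<epsilon> :: nat \<Rightarrow> real) (r :: nat \<Rightarrow> real). \<epsilon> \<in> o(\<lambda>_. 1) \<and> r \<in> O(\<lambda>n. 1 / real n) \<and>
       (\<forall>\<^sub>F n in sequentially. \<forall>h\<in>H n.
         enn2ereal ((risk (M n) x f (kernel_estimator n fX K (X n) (Y n) h) 2)\<^sup>2) \<ge>
           enn2ereal ((section_norm x 2 (\<lambda>z. conv (scaled_kernel K h) f z - f z))\<^sup>2)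
           + ereal ((enn2real (Lnorm 2 K))\<^sup>2 / (fX x * real n * (\<Prod>i\<in>UNIV. h $ i)) * (1 + \<epsilon> n))
           + ereal (r n))))" (is "?nonasymptotic \<and> (_ \<longrightarrow> _ \<longrightarrow> ?asymptotic)")
  proof (intro conjI impI)
    show ?nonasymptotic by (intro allI impI ballI bound)
  next
    assume "\<exists>U. open U \<and> x \<in> U \<and> (\<forall>t\<in>U. 0 < fX t) \<and> continuous_on U fX"
    then have cont: "isCont fX x"
      by (auto simp: continuous_on_eq_continuous_at)
    define \<epsilon> where "\<epsilon> n = density_ratio_defect A fX x (H n)" for n
    define F where "F = enn2real (sup_on (nbhd_box A x (k 1)) f)"
    define r where "r n = - (F * (enn2real (Lnorm 1 K))\<^sup>2) / real n" for n
    have F: "sup_on (nbhd_box A x (k 1)) f = ennreal F" "0 \<le> F"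
      using sup by (auto simp: F_def)
    have "\<epsilon> \<in> o(\<lambda>_. 1)"
      using density_ratio_defect_tendsto_0[OF _ cont A k H] fX
      by (intro smalloI_tendsto) (auto simp: \<epsilon>_def[abs_def])
    moreover have "r \<in> O(\<lambda>n. 1 / real n)"
      by (intro bigoI[where c = "F * (enn2real (Lnorm 1 K))\<^sup>2"]) (use F(2) in \<open>auto simp: r_def abs_mult\<close>)
    moreover have "\<forall>\<^sub>F n in sequentially. \<forall>h\<in>H n.
         enn2ereal ((risk (M n) x f (kernel_estimator n fX K (X n) (Y n) h) 2)\<^sup>2) \<ge>
           enn2ereal ((section_norm x 2 (\<lambda>z. conv (scaled_kernel K h) f z - f z))\<^sup>2)
           + ereal ((enn2real (Lnorm 2 K))\<^sup>2 / (fX x * real n * (\<Prod>i\<in>UNIV. h $ i)) * (1 + \<epsilon> n))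
           + ereal (r n)"
    proof -
      \<comment> \<open>The sequence k tends to infinity but need not be monotone, so its boxes are
        only eventually contained in the one for index 1.\<close>
      have "eventually (\<lambda>n. k 1 \<le> k n \<and> 1 \<le> n) sequentially"
        using k(2) by (intro eventually_conj eventually_ge_at_top) (auto simp: filterlim_at_top)
      then show ?thesis
      proof (rule eventually_mono, intro ballI)
        fix n h assume n: "k 1 \<le> k n \<and> 1 \<le> n" and h: "h \<in> H n"
        let ?R = "(risk (M n) x f (kernel_estimator n fX K (X n) (Y n) h) 2)\<^sup>2"
        let ?B = "(section_norm x 2 (\<lambda>z. conv (scaled_kernel K h) f z - f z))\<^sup>2"
        let ?q = "real n * (\<Prod>i\<in>UNIV. h $ i)"
        let ?V = "(Lnorm 2 K2)\<^sup>2 / ennreal ?q *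
          (\<integral>\<^sup>+ s. ennreal ((K1 s)\<^sup>2 / fX (x - (\<chi> i. s $ i * h $ Inl i))) \<partial>lborel)"
        let ?v = "(enn2real (Lnorm 2 K))\<^sup>2 / ?q * ((1 + \<epsilon> n) / fX x)"
        have "0 < k 1" using k(1) by (auto intro: less_trans[of 0 1])
        then have "sup_on (nbhd_box A x (k n)) f \<le> ennreal F"
          unfolding F(1)[symmetric] using n A by (intro sup_on_mono nbhd_box_antimono) auto
        then have low: "enn2ereal ?R \<ge> enn2ereal (?B + ?V) + ereal (r n)"
          unfolding r_def using n h F(2) by (intro bound) auto
        have "0 < (\<Prod>i\<in>UNIV. h $ i)" using H h n by (auto intro!: prod_pos)
        then have q: "0 < ?q" using n by auto
        \<comment> \<open>Nonnegativity matters because \<open>ennreal\<close> truncates negative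
          reals to 0; it makes the later passage from \<open>ennreal ?v\<close> to
          \<open>ereal ?v\<close> exact.\<close>
        have \<epsilon>: "0 \<le> (1 + \<epsilon> n) / fX x"
          using density_ratio_defect_bounds(1)[of fX A x "H n"] fX by (simp add: \<epsilon>_def less_imp_le)
        have "ennreal ?v \<le> ?V"
        proof (rule variance_term_ge[OF K12])
          show "(1 + \<epsilon> n) / fX x \<le> 1 / fX (x - (\<chi> i. s $ i * h $ Inl i))" if "K1 s \<noteq> 0" for s
            unfolding \<epsilon>_def using that supp fX h by (intro density_ratio_defect_bounds) auto
        qed (use prod K(3) q \<epsilon> in auto)
        then have "enn2ereal (?B + ennreal ?v) + ereal (r n) \<le> enn2ereal (?B + ?V) + ereal (r n)"
          by (intro add_right_mono) (simp add: less_eq_ennreal.rep_eq[symmetric] add_left_mono)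
        also note low
        also have "enn2ereal (?B + ennreal ?v) = enn2ereal ?B + ereal ?v"
          using q \<epsilon> by (simp only: plus_ennreal.rep_eq enn2ereal_ennreal mult_nonneg_nonneg
              divide_nonneg_pos zero_le_power2)
        also have "?v = (enn2real (Lnorm 2 K))\<^sup>2 / (fX x * real n * (\<Prod>i\<in>UNIV. h $ i)) * (1 + \<epsilon> n)"
          by (simp add: ac_simps)
        finally show "enn2ereal ?R \<ge> enn2ereal ?B
          + ereal ((enn2real (Lnorm 2 K))\<^sup>2 / (fX x * real n * (\<Prod>i\<in>UNIV. h $ i)) * (1 + \<epsilon> n))
          + ereal (r n)" .
      qed
    qed
    ultimately show ?asymptotic by (intro exI conjI)
  qed
qed

end
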